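(* For $i=1,2$ let $f_i,g_i$ be polynomials in $z$ with complex coefficients, of degrees $N_i,m_i$ respectively, written $$f_i(z)=\sum_{n=0}^{N_i}a_{i,n}z^n,\qquad g_i(z)=\sum_{n=0}^{m_i}a_{i,-n}z^n,$$ where $a_{i,N_i}\,a_{i,-m_i}\neq 0$ for $i=1,2$. Put $\phi_i(z)=f_i(z)+\overline{g_i(z)}$ and define on the open unit disk $\mathbb{D}$ $$\Phi(z)=\phi_1(z)+|z|^2\phi_2(z).$$ Then the Toeplitz operator $T_\Phi$ on the Bergman space $L^2_a(\mathbb{D})$ is normal if and only if $\Phi$ is constant or the image $\Phi(\mathbb{D})$ lies on a line in $\mathbb{C}$.
   Context: $\mathbb{D}$ is the open unit disk in $\mathbb{C}$, equipped with the normalized area measure $dA=r\,dr\,\frac{d\theta}{\pi}$. The Bergman space $L^2_a(\mathbb{D})$ is the closed subspace of $L^2(\mathbb{D},dA)$ consisting of analytic functions, and $P:L^2(\mathbb{D},dA)\to L^2_a(\mathbb{D})$ is the orthogonal (Bergman) projection. For a bounded measurable function $f$ on $\mathbb{D}$, the Toeplitz operator with symbol $f$ is the bounded operator $T_f(g)=P(fg)$, $g\in L^2_a(\mathbb{D})$. The operator $T_f$ is normal if $T_fT_f^*=T_f^*T_f$, where $T_f^*=T_{\overline f}$. In the coefficient notation, $a_{i,0}$ (the constant term of $f_i$) and $a_{i,-0}$ (the constant term of $g_i$) are different, unrelated symbols. *)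

theory Defs
  imports "HOL-Complex_Analysis.Complex_Analysis" "HOL-Computational_Algebra.Polynomial"
begin

abbreviation unit_disk :: "complex set" where
  "unit_disk \<equiv> ball 0 1"

(* In polar coordinates this is r dr dtheta / pi; it lives on the disk only, so values of
   functions outside the disk are irrelevant to it. *)
definition disk_area :: "complex measure" where
  "disk_area = density (restrict_space lborel unit_disk) (\<lambda>_. ennreal (1 / pi))"

definition L2_disk :: "(complex \<Rightarrow> complex) set" where
  "L2_disk = {f \<in> borel_measurable disk_area. integrable disk_area (\<lambda>z. (cmod (f z))\<^sup>2)}"

definition L2_inner :: "(complex \<Rightarrow> complex) \<Rightarrow> (complex \<Rightarrow> complex) \<Rightarrow> complex" where
  "L2_inner f g = (LINT z|disk_area. f z * cnj (g z))"

(* Elements are extended by 0 outside the disk, so that every element of the Bergman space is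
   represented by exactly one total function (an almost-everywhere class contains at most one
   analytic function). *)
definition bergman_space :: "(complex \<Rightarrow> complex) set" where
  "bergman_space = {g \<in> L2_disk. g holomorphic_on unit_disk \<and> (\<forall>z. z \<notin> unit_disk \<longrightarrow> g z = 0)}"

(* Orthogonal projection of L2_disk onto bergman_space; meaningful for arguments in L2_disk only. *)
definition bergman_proj :: "(complex \<Rightarrow> complex) \<Rightarrow> complex \<Rightarrow> complex" where
  "bergman_proj f =
     (THE h. h \<in> bergman_space \<and> (\<forall>k\<in>bergman_space. L2_inner (\<lambda>z. f z - h z) k = 0))"

definition toeplitz :: "(complex \<Rightarrow> complex) \<Rightarrow> (complex \<Rightarrow> complex) \<Rightarrow> complex \<Rightarrow> complex" where
  "toeplitz f g = bergman_proj (\<lambda>z. f z * g z)"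

definition bergman_adjoint ::
  "((complex \<Rightarrow> complex) \<Rightarrow> complex \<Rightarrow> complex) \<Rightarrow> ((complex \<Rightarrow> complex) \<Rightarrow> complex \<Rightarrow> complex) \<Rightarrow> bool" where
  "bergman_adjoint T S \<longleftrightarrow>
     (\<forall>g\<in>bergman_space. S g \<in> bergman_space) \<and>
     (\<forall>g\<in>bergman_space. \<forall>h\<in>bergman_space. L2_inner (T g) h = L2_inner g (S h))"

(* The adjoint is determined uniquely on bergman_space. For T = toeplitz f with f bounded and
   measurable it is toeplitz (%z. cnj (f z)). *)
definition bergman_normal :: "((complex \<Rightarrow> complex) \<Rightarrow> complex \<Rightarrow> complex) \<Rightarrow> bool" where
  "bergman_normal T \<longleftrightarrow>
     (\<forall>g\<in>bergman_space. T g \<in> bergman_space) \<and>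
     (\<exists>S. bergman_adjoint T S \<and> (\<forall>g\<in>bergman_space. T (S g) = S (T g)))"

end

theory Submission
  imports Defs
begin

text \<open>
  If \<Phi> maps the disk into a line, then cnj \<Phi> = \<kappa>\<Phi> + \<mu> there with constants \<kappa> and \<mu>, so the adjoint
  of T = T_\<Phi> is \<kappa>T + \<mu>, which commutes with T (toeplitz_normalI).

  For the converse write \<Phi> = u + iv with u and v real. Normality means that T_u and T_v commute. All
  monomials satisfy \<langle>z^a cnj(z)^b, 1\<rangle> = [a = b] / (a + 1), so the matrix of u with respect to the
  powers of z is
    \<langle>u z^n, z^m\<rangle> = P(m - n) / (max n m + 1) + Q(m - n) / (max n m + 2),
  where P and Q : int \<Rightarrow> complex have finite support and satisfy P(-k) = cnj P(k), Q(-k) = cnj Q(k).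
  The coefficients of |z|^2 are in Q and those of the harmonic part in P; let R and S be the
  corresponding functions for v. Along the diagonal m = n + d, the (n, m) entry of the commutator is,
  for large n, a finite sum of rational functions of n. It vanishes for all large integers, hence
  identically, and its poles can be inspected one at a time (residue_zero).

  The double pole at n = -i - 2, for i \<ge> max d 1, gives S(i) Q(d - i) = Q(i) S(d - i)
  (double_pole_relation). Together with the symmetry of Q and S this makes Q and S proportional over
  the reals, so some real combination of u and v is harmonic. It therefore suffices to let v be
  harmonic, v = E. If E is not constant and Q \<noteq> 0, let e \<ge> 1 and q \<ge> 0 be the largest indices in
  their supports; on the diagonal d = e + q, after multiplication by n + d + 1, the pole at n = -q - 2
  has the residue E(e) Q(q) up to sign, and nothing cancels it (harmonic_commute_top_product). So Q = 0 and u is harmonic as well. Then the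
  poles at n = -i - 1 for i > d give E(i) P(d - i) = P(i) E(d - i) (harmonic_relation), and P is a real
  multiple of E away from the index 0. In every case a nontrivial real combination of u and v is
  constant (entries_commute_dependent), that is, \<Phi> maps the disk into a line.

  What this needs of the Bergman space is that a function in it is determined by its inner products
  with the powers of z, and that the projection of f is the power series whose n-th coefficient is
  (n + 1) \<langle>f, z^n\<rangle> (bergman_proj_eq_series).
\<close>

section \<open>Invariance of Lebesgue measure under isometries\<close>

lemma isometry_vimage_ball:
  fixes T :: "'a::metric_space \<Rightarrow> 'a"
  assumes "\<And>x y. dist (T x) (T y) = dist x y" and "\<And>x. T (T' x) = x"
  shows "T -` ball a r = ball (T' a) r"
proof -
  have "dist a (T x) = dist (T' a) x" for x
    using assms by metis
  then show ?thesis by auto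
qed

lemma isometry_continuous:
  assumes "\<And>x y. dist (T x) (T y) = dist x y"
  shows "continuous_on UNIV T"
  unfolding continuous_on_iff by (auto simp: assms)

text \<open>
  An isometry pulls a ball back to a ball of the same radius, hence of the same volume. By the Vitali
  covering theorem an open set is a disjoint union of countably many balls up to a null set, and these
  balls pull back to disjoint sets inside the preimage. The inequality in the other direction is this
  one for the inverse isometry.
\<close>
lemma emeasure_open_le_isometry_vimage:
  fixes T :: "'a::euclidean_space \<Rightarrow> 'a"
  assumes iso: "\<And>x y. dist (T x) (T y) = dist x y" and inv: "\<And>x. T (T' x) = x"
    and U: "open U"
  shows "emeasure lborel U \<le> emeasure lborel (T -` U)"
proof -
  have T_meas [measurable]: "T \<in> borel_measurable borel"
    by (rule borel_measurable_continuous_onI[OF isometry_continuous[OF iso]])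
  define K where "K = {(a, r). ball a r \<subseteq> U}"
  define B where "B = (\<lambda>p::'a \<times> real. ball (fst p) (snd p))"
  obtain C where C: "countable C" "C \<subseteq> K"
    "pairwise (\<lambda>i j. disjnt (ball (fst i) (snd i)) (ball (fst j) (snd j))) C"
    "negligible (U - (\<Union>i\<in>C. ball (fst i) (snd i)))"
  proof (rule Vitali_covering_theorem_balls[of U K fst snd])
    fix x and d :: real assume x: "x \<in> U" and d: "0 < d"
    obtain e where e: "e > 0" "ball x e \<subseteq> U"
      using U x open_contains_ball by blast
    have "(x, min (d/2) e) \<in> K"
      using e unfolding K_def by auto
    then show "\<exists>i. i \<in> K \<and> x \<in> ball (fst i) (snd i) \<and> snd i < d"
      using d e by (intro exI[of _ "(x, min (d/2) e)"]) auto
  qed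
  have disj: "disjoint_family_on B C"
    using C(3) unfolding B_def disjoint_family_on_def pairwise_def disjnt_def by blast
  have sub: "(\<Union>i\<in>C. B i) \<subseteq> U"
    using C(2) unfolding K_def B_def by fastforce
  have opn: "open (\<Union>i\<in>C. B i)"
    unfolding B_def by auto
  have null: "U - (\<Union>i\<in>C. B i) \<in> null_sets lborel"
    using C(4) U opn unfolding B_def[symmetric] negligible_iff_null_sets
    by (subst null_sets_completion_iff[symmetric]) auto
  have "emeasure lborel U = emeasure lborel ((\<Union>i\<in>C. B i) \<union> (U - (\<Union>i\<in>C. B i)))"
    using sub by (simp add: Un_absorb1)
  also have "\<dots> = emeasure lborel (\<Union>i\<in>C. B i)"
    using null opn by (intro emeasure_Un_null_set) auto
  also have "\<dots> = (\<integral>\<^sup>+i. emeasure lborel (B i) \<partial>count_space C)"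
    using C(1) disj by (intro emeasure_UN_countable) (auto simp: B_def)
  also have "\<dots> = (\<integral>\<^sup>+i. emeasure lborel (T -` B i) \<partial>count_space C)"
  proof (intro nn_integral_cong)
    fix i
    show "emeasure lborel (B i) = emeasure lborel (T -` B i)"
    proof (cases "snd i \<ge> 0")
      case True
      then show ?thesis
        unfolding B_def isometry_vimage_ball[OF iso inv] by (simp add: emeasure_ball)
    qed (simp add: B_def ball_empty)
  qed
  also have "\<dots> = emeasure lborel (\<Union>i\<in>C. T -` B i)"
  proof (rule emeasure_UN_countable[symmetric])
    show "disjoint_family_on (\<lambda>i. T -` B i) C"
      using disj unfolding disjoint_family_on_def by blast
    show "T -` B i \<in> sets lborel" for i
      unfolding B_def isometry_vimage_ball[OF iso inv] by simp
  qed (use C in auto)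
  also have "\<dots> \<le> emeasure lborel (T -` U)"
    using sub U measurable_sets[OF T_meas, of U] by (intro emeasure_mono) auto
  finally show ?thesis .
qed

proposition lborel_distr_isometry:
  fixes T :: "'a::euclidean_space \<Rightarrow> 'a"
  assumes iso: "\<And>x y. dist (T x) (T y) = dist x y" and inv: "\<And>x. T (T' x) = x"
  shows "distr lborel borel T = lborel"
proof -
  have T_meas [measurable]: "T \<in> borel_measurable borel"
    by (rule borel_measurable_continuous_onI[OF isometry_continuous[OF iso]])
  have iso': "dist (T' x) (T' y) = dist x y" for x y
    using iso inv by metis
  have inv': "T' (T x) = x" for x
    using iso inv by (metis dist_eq_0_iff)
  have eq: "emeasure lborel (T -` U) = emeasure lborel U" if "open U" for U
  proof (rule antisym)
    have "open (T -` U)"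
      using isometry_continuous[OF iso] that by (simp add: continuous_on_open_vimage)
    then have "emeasure lborel (T -` U) \<le> emeasure lborel (T' -` (T -` U))"
      by (rule emeasure_open_le_isometry_vimage[of T' T, OF iso' inv'])
    also have "T' -` (T -` U) = U" using inv by auto
    finally show "emeasure lborel (T -` U) \<le> emeasure lborel U" .
  qed (rule emeasure_open_le_isometry_vimage[OF iso inv that])
  show ?thesis
    by (rule lborel_eqI[symmetric]) (auto simp: emeasure_distr eq open_box emeasure_lborel_box)
qed

lemma complex_lborel_distr_rotation:
  assumes "cmod \<omega> = 1"
  shows "distr lborel borel (\<lambda>z. \<omega> * z) = lborel"
proof (rule lborel_distr_isometry[where T' = "\<lambda>z. z / \<omega>"])
  show "dist (\<omega> * x) (\<omega> * y) = dist x y" for x y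
    using assms by (simp add: dist_norm norm_mult flip: right_diff_distrib)
qed (use assms in auto)

section \<open>Area measure on the disk and its moments\<close>

lemma sets_disk_area [measurable_cong]: "sets disk_area = sets (restrict_space borel unit_disk)"
  by (simp add: disk_area_def sets_restrict_space)

lemma space_disk_area [simp]: "space disk_area = unit_disk"
  by (simp add: disk_area_def space_restrict_space)

lemma borel_measurable_disk_area:
  "(f::complex \<Rightarrow> 'b::topological_space) \<in> borel_measurable borel \<Longrightarrow> f \<in> borel_measurable disk_area"
  unfolding measurable_cong_sets[OF sets_disk_area refl] by (rule measurable_restrict_space1)

lemma borel_measurable_disk_area_continuous:
  "continuous_on unit_disk f \<Longrightarrow> f \<in> borel_measurable disk_area"
  for f :: "complex \<Rightarrow> 'b::topological_space"
  unfolding measurable_cong_sets[OF sets_disk_area refl]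
  by (rule borel_measurable_continuous_on_restrict)

lemma nn_integral_disk_area:
  assumes [measurable]: "f \<in> borel_measurable disk_area"
  shows "(\<integral>\<^sup>+z. f z \<partial>disk_area) = ennreal (1/pi) * (\<integral>\<^sup>+z. f z * indicator unit_disk z \<partial>lborel)"
proof -
  have [measurable]: "f \<in> borel_measurable (restrict_space lborel unit_disk)"
    using assms unfolding disk_area_def by simp
  have "(\<integral>\<^sup>+z. f z \<partial>disk_area) = (\<integral>\<^sup>+z. ennreal (1/pi) * f z \<partial>restrict_space lborel unit_disk)"
    unfolding disk_area_def by (subst nn_integral_density) auto
  also have "\<dots> = ennreal (1/pi) * (\<integral>\<^sup>+z. f z \<partial>restrict_space lborel unit_disk)"
    by (subst nn_integral_cmult) auto
  finally show ?thesis by (simp add: nn_integral_restrict_space)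
qed

lemma emeasure_disk_area:
  assumes "A \<in> sets borel" "A \<subseteq> unit_disk"
  shows "emeasure disk_area A = ennreal (1/pi) * emeasure lborel A"
proof -
  have A: "A \<in> sets disk_area"
    using assms by (auto simp: sets_disk_area sets_restrict_space)
  have "emeasure disk_area A = (\<integral>\<^sup>+z. indicator A z \<partial>disk_area)"
    using A by simp
  also have "\<dots> = ennreal (1/pi) * (\<integral>\<^sup>+z. indicator A z * indicator unit_disk z \<partial>lborel)"
    using A by (intro nn_integral_disk_area) auto
  also have "(\<lambda>z. indicator A z * indicator unit_disk z :: ennreal) = indicator A"
    using assms by (auto simp: fun_eq_iff indicator_def)
  finally show ?thesis using assms by simp
qed

lemma emeasure_disk_area_ball:
  assumes "0 \<le> r" "r \<le> 1"
  shows "emeasure disk_area (ball 0 r) = ennreal (r\<^sup>2)"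
  using assms by (subst emeasure_disk_area)
    (auto simp: emeasure_ball unit_ball_vol_2 field_simps simp flip: ennreal_mult)

lemma finite_measure_disk_area: "finite_measure disk_area"
  using emeasure_disk_area_ball[of 1] by (intro finite_measureI) auto

interpretation disk_area: finite_measure disk_area
  by (rule finite_measure_disk_area)

lemma disk_area_distr_rotation:
  assumes \<omega>: "cmod \<omega> = 1"
  shows "distr disk_area disk_area (\<lambda>z. \<omega> * z) = disk_area"
proof (rule measure_eqI)
  fix A assume "A \<in> sets (distr disk_area disk_area (\<lambda>z. \<omega> * z))"
  then have A: "A \<in> sets disk_area" by simp
  then have A': "A \<in> sets borel" "A \<subseteq> unit_disk"
    by (auto simp: sets_disk_area sets_restrict_space)
  have meas [measurable]: "(\<lambda>z. \<omega> * z) \<in> borel \<rightarrow>\<^sub>M borel" by measurable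
  have m: "(\<lambda>z. \<omega> * z) \<in> disk_area \<rightarrow>\<^sub>M disk_area"
    unfolding measurable_cong_sets[OF sets_disk_area sets_disk_area]
    by (rule measurable_restrict_space3) (auto simp: norm_mult \<omega>)
  have sub: "(\<lambda>z. \<omega> * z) -` A \<subseteq> unit_disk"
    using A'(2) \<omega> by (auto simp: norm_mult)
  have "emeasure (distr disk_area disk_area (\<lambda>z. \<omega> * z)) A = emeasure disk_area ((\<lambda>z. \<omega> * z) -` A)"
    using A m sub by (subst emeasure_distr) (auto simp: Int_absorb2)
  also have "\<dots> = ennreal (1/pi) * emeasure lborel ((\<lambda>z. \<omega> * z) -` A)"
    using measurable_sets[OF meas A'(1)] sub by (intro emeasure_disk_area) auto
  also have "emeasure lborel ((\<lambda>z. \<omega> * z) -` A) = emeasure (distr lborel borel (\<lambda>z. \<omega> * z)) A"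
    using A' by (subst emeasure_distr) auto
  also have "\<dots> = emeasure lborel A" by (simp add: complex_lborel_distr_rotation[OF \<omega>])
  finally show "emeasure (distr disk_area disk_area (\<lambda>z. \<omega> * z)) A = emeasure disk_area A"
    using emeasure_disk_area[OF A'] by simp
qed simp

text \<open>
  The disk of radius r has normalized area r^2, so the square of the modulus is uniformly distributed on
  [0, 1]. This takes the place of polar coordinates: it turns integrals of radial functions into
  integrals over [0, 1].
\<close>
lemma disk_area_distr_cmod_square:
  "distr disk_area borel (\<lambda>z. (cmod z)\<^sup>2) = density lborel (indicator {0..1})"
proof (rule measure_eqI_lessThan)
  have m: "(\<lambda>z. (cmod z)\<^sup>2) \<in> borel_measurable disk_area"
    by (rule borel_measurable_disk_area) measurable
  fix x :: real
  have "finite_measure (distr disk_area borel (\<lambda>z. (cmod z)\<^sup>2))"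
    using m by (rule disk_area.finite_measure_distr)
  then show "emeasure (distr disk_area borel (\<lambda>z. (cmod z)\<^sup>2)) {x<..} < \<infinity>"
    by (metis finite_measure.emeasure_finite infinity_ennreal_def less_top)
  consider "x < 0" | "0 \<le> x" "x \<le> 1" | "1 < x" by linarith
  then have "emeasure disk_area ({z\<in>unit_disk. x < (cmod z)\<^sup>2}) = emeasure lborel ({0..1} \<inter> {x<..})"
  proof cases
    case 1
    then have "{z\<in>unit_disk. x < (cmod z)\<^sup>2} = ball 0 1"
      using zero_le_power2 by (auto intro: less_le_trans)
    moreover have "{0..1} \<inter> {x<..} = {0..1}" using 1 by auto
    ultimately show ?thesis using emeasure_disk_area_ball[of 1] by simp
  next
    case 2
    have "emeasure lborel (sphere (0::complex) (sqrt x)) = 0"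
    proof -
      have "sphere (0::complex) (sqrt x) \<in> null_sets lborel"
        using negligible_sphere[of "0::complex" "sqrt x"]
        by (auto simp: null_sets_completion_iff negligible_iff_null_sets)
      then show ?thesis by auto
    qed
    have *: "(x < (cmod z)\<^sup>2) \<longleftrightarrow> sqrt x < cmod z" for z
      using 2 by (metis norm_ge_zero real_less_lsqrt real_sqrt_less_iff real_sqrt_unique abs_of_nonneg real_sqrt_abs)
    have "{z\<in>unit_disk. x < (cmod z)\<^sup>2} = ball 0 1 - cball 0 (sqrt x)"
      unfolding * by auto
    moreover have "emeasure disk_area (ball 0 1 - cball 0 (sqrt x)) =
        ennreal (1/pi) * emeasure lborel (ball (0::complex) 1 - cball 0 (sqrt x))"
      by (rule emeasure_disk_area) auto
    moreover have "emeasure lborel (ball (0::complex) 1 - cball 0 (sqrt x)) = ennreal (pi * (1 - x))"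
    proof (cases "x = 1")
      case True
      then have *: "ball (0::complex) 1 - cball 0 (sqrt x) = {}" by auto
      show ?thesis unfolding * using True by simp
    next
      case False
      have "sqrt x < 1" using 2 False by simp
      then have sub: "cball (0::complex) (sqrt x) \<subseteq> ball 0 1"
        by (simp add: cball_subset_ball_iff)
      have fin: "emeasure lborel (cball (0::complex) (sqrt x)) \<noteq> \<infinity>"
        using 2 by (simp add: emeasure_cball)
      show ?thesis
        using 2 fin sub by (subst emeasure_Diff)
          (auto simp: emeasure_ball emeasure_cball unit_ball_vol_2 ennreal_minus right_diff_distrib)
    qed
    moreover have "emeasure lborel ({0..1} \<inter> {x<..}) = ennreal (1 - x)"
    proof -
      have "{0..1} \<inter> {x<..} = {x<..1}" using 2 by auto
      then show ?thesis using 2 by simp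
    qed
    ultimately show ?thesis
      using 2 by (simp add: flip: ennreal_mult)
  next
    case 3
    have "(cmod z)\<^sup>2 < x" if "cmod z < 1" for z
      using that 3 by (smt (verit) norm_ge_zero power_le_one)
    then have "{z\<in>unit_disk. x < (cmod z)\<^sup>2} = {}" by fastforce
    moreover have "{0..1} \<inter> {x<..} = {}" using 3 by auto
    ultimately show ?thesis by (simp only: emeasure_empty)
  qed
  then show "emeasure (distr disk_area borel (\<lambda>z. (cmod z)\<^sup>2)) {x<..} =
      emeasure (density lborel (indicator {0..1})) {x<..}"
    using m by (simp add: emeasure_distr emeasure_density emeasure_lborel_Icc
        vimage_def Int_def conj_commute flip: indicator_inter_arith)
qed auto



lemma disk_moment_radial:
  assumes r: "0 \<le> r" "r \<le> 1"
  shows "(LINT z|disk_area. indicator (cball 0 r) z * (z ^ a * cnj z ^ a)) =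
    of_real (r ^ (2 * a + 2) / (real a + 1))"
proof -
  define g where "g = (\<lambda>t::real. indicator {..r\<^sup>2} t * t ^ a)"
  have g [measurable]: "g \<in> borel_measurable borel"
    unfolding g_def by measurable
  have m: "(\<lambda>z. (cmod z)\<^sup>2) \<in> borel_measurable disk_area"
    by (rule borel_measurable_disk_area) measurable
  have "indicator (cball 0 r) z * (z ^ a * cnj z ^ a) = of_real (g ((cmod z)\<^sup>2))" for z :: complex
  proof -
    have "z ^ a * cnj z ^ a = of_real (((cmod z)\<^sup>2) ^ a)"
      by (metis complex_norm_square of_real_power power_mult_distrib)
    moreover have "cmod z \<le> r \<longleftrightarrow> (cmod z)\<^sup>2 \<le> r\<^sup>2"
      using r power_mono_iff[of "cmod z" r 2] by simp
    ultimately show ?thesis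
      by (auto simp: g_def indicator_def)
  qed
  then have "(LINT z|disk_area. indicator (cball 0 r) z * (z ^ a * cnj z ^ a)) =
      of_real (LINT z|disk_area. g ((cmod z)\<^sup>2))"
    by simp
  also have "(LINT z|disk_area. g ((cmod z)\<^sup>2)) = (LINT t|distr disk_area borel (\<lambda>z. (cmod z)\<^sup>2). g t)"
    using integral_distr[OF m g] by simp
  also have "\<dots> = (LINT t|density lborel (\<lambda>t. ennreal (indicator {0..1} t)). g t)"
    by (simp add: disk_area_distr_cmod_square ennreal_indicator)
  also have "\<dots> = (LINT t|lborel. indicator {0..1} t *\<^sub>R g t)"
    by (intro integral_density) auto
  also have "\<dots> = (LINT t|lborel. t ^ a * indicator {0..r\<^sup>2} t)"
    using r by (intro Bochner_Integration.integral_cong)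
      (auto simp: g_def indicator_def power_le_one intro: order_trans)
  also have "\<dots> = r ^ (2 * a + 2) / (real a + 1)"
  proof -
    have "(r\<^sup>2) ^ Suc a = r ^ (2 * a + 2)"
      by (metis power_mult mult_Suc_right add.commute)
    then show ?thesis by (subst integral_power) (auto simp: add.commute)
  qed
  finally show ?thesis .
qed

text \<open>
  If a \<noteq> b, some rotation multiplies z^a cnj(z)^b by -1, and it preserves both the measure and the disk
  of radius r; so the integral equals its negative. The smaller disks, of radius r < 1, are needed
  because a power series converges uniformly only there.
\<close>
lemma disk_moment:
  assumes r: "0 \<le> r" "r \<le> 1"
  shows "(LINT z|disk_area. indicator (cball 0 r) z * (z ^ a * cnj z ^ b)) =
    (if a = b then of_real (r ^ (2 * a + 2) / (real a + 1)) else 0)"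
proof (cases "a = b")
  case True
  then show ?thesis using disk_moment_radial[OF r, of a] by simp
next
  case False
  define I where "I = (LINT z|disk_area. indicator (cball 0 r) z * (z ^ a * cnj z ^ b))"
  \<comment> \<open>The rotation by pi / (a - b) multiplies the integrand by cis pi = -1.\<close>
  define t where "t = pi / (real a - real b)"
  have "(real a - real b) * t = pi"
    using False by (simp add: t_def)
  then have "real a * t + - (real b * t) = pi"
    by (simp add: left_diff_distrib)
  then have half_turn: "cis t ^ a * cnj (cis t) ^ b = -1"
    by (simp add: cis_cnj Complex.DeMoivre cis_mult cis_pi)
  have m: "(\<lambda>z. cis t * z) \<in> disk_area \<rightarrow>\<^sub>M disk_area"
    unfolding measurable_cong_sets[OF sets_disk_area sets_disk_area]
    by (rule measurable_restrict_space3) (auto simp: norm_mult)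
  have f: "(\<lambda>z. indicator (cball 0 r) z * (z ^ a * cnj z ^ b)) \<in> borel_measurable disk_area"
    by (intro borel_measurable_disk_area borel_measurable_times borel_measurable_indicator
        borel_measurable_continuous_onI continuous_intros) auto
  have "I = (LINT z|distr disk_area disk_area (\<lambda>z. cis t * z). indicator (cball 0 r) z * (z ^ a * cnj z ^ b))"
    by (simp add: disk_area_distr_rotation I_def)
  also have "\<dots> = (LINT z|disk_area. indicator (cball 0 r) (cis t * z) * ((cis t * z) ^ a * cnj (cis t * z) ^ b))"
    using m f by (rule integral_distr)
  also have "\<dots> = (LINT z|disk_area. (cis t ^ a * cnj (cis t) ^ b) * (indicator (cball 0 r) z * (z ^ a * cnj z ^ b)))"
    by (intro Bochner_Integration.integral_cong)
      (auto simp: power_mult_distrib norm_mult indicator_def mult_ac)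
  also have "\<dots> = - I"
    unfolding half_turn by (simp add: I_def)
  finally show ?thesis using False by (simp add: I_def)
qed

section \<open>Square-integrable functions on the disk\<close>

lemma L2_diskD:
  assumes "f \<in> L2_disk"
  shows "f \<in> borel_measurable disk_area" "integrable disk_area (\<lambda>z. (cmod (f z))\<^sup>2)"
  using assms by (auto simp: L2_disk_def)

lemma L2_diskI_bound:
  assumes "f \<in> borel_measurable disk_area" "integrable disk_area w"
    and "\<And>z. z \<in> unit_disk \<Longrightarrow> (cmod (f z))\<^sup>2 \<le> w z"
  shows "f \<in> L2_disk"
proof -
  have "integrable disk_area (\<lambda>z. (cmod (f z))\<^sup>2)"
    using assms by (intro Bochner_Integration.integrable_bound[OF assms(2)])
      (auto intro!: AE_I2 intro: order_trans[OF _ abs_ge_self])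
  with assms(1) show ?thesis by (simp add: L2_disk_def)
qed

lemma L2_disk_add:
  assumes "f \<in> L2_disk" "g \<in> L2_disk"
  shows "(\<lambda>z. f z + g z) \<in> L2_disk"
proof (rule L2_diskI_bound)
  show "integrable disk_area (\<lambda>z. 2 * (cmod (f z))\<^sup>2 + 2 * (cmod (g z))\<^sup>2)"
    using assms by (auto simp: L2_disk_def)
  show "(cmod (f z + g z))\<^sup>2 \<le> 2 * (cmod (f z))\<^sup>2 + 2 * (cmod (g z))\<^sup>2" for z
  proof -
    have "(cmod (f z + g z))\<^sup>2 \<le> (cmod (f z) + cmod (g z))\<^sup>2"
      by (simp add: norm_triangle_ineq power_mono)
    also have "\<dots> \<le> 2 * (cmod (f z))\<^sup>2 + 2 * (cmod (g z))\<^sup>2"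
      using zero_le_power2[of "cmod (f z) - cmod (g z)"] by (simp add: power2_eq_square algebra_simps)
    finally show ?thesis .
  qed
qed (use assms in \<open>auto simp: L2_disk_def\<close>)

lemma L2_disk_bounded_mult:
  assumes u: "u \<in> borel_measurable disk_area" and b: "\<And>z. z \<in> unit_disk \<Longrightarrow> cmod (u z) \<le> B"
    and f: "f \<in> L2_disk"
  shows "(\<lambda>z. u z * f z) \<in> L2_disk"
proof (rule L2_diskI_bound)
  show "integrable disk_area (\<lambda>z. B\<^sup>2 * (cmod (f z))\<^sup>2)"
    using f by (auto simp: L2_disk_def)
  show "(cmod (u z * f z))\<^sup>2 \<le> B\<^sup>2 * (cmod (f z))\<^sup>2" if "z \<in> unit_disk" for z
    using b[OF that] by (auto simp: norm_mult power_mult_distrib intro!: mult_right_mono power_mono)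
qed (use u f in \<open>auto simp: L2_disk_def\<close>)

lemma L2_disk_cmult: "f \<in> L2_disk \<Longrightarrow> (\<lambda>z. c * f z) \<in> L2_disk"
  by (rule L2_disk_bounded_mult[where B = "cmod c"]) auto

lemma L2_disk_diff:
  assumes "f \<in> L2_disk" "g \<in> L2_disk"
  shows "(\<lambda>z. f z - g z) \<in> L2_disk"
  using L2_disk_add[OF assms(1) L2_disk_cmult[OF assms(2), of "-1"]] by simp

lemma L2_disk_zero: "(\<lambda>z. 0) \<in> L2_disk"
  by (simp add: L2_disk_def)

lemma L2_disk_sum: "(\<And>i. i \<in> I \<Longrightarrow> f i \<in> L2_disk) \<Longrightarrow> (\<lambda>z. \<Sum>i\<in>I. f i z) \<in> L2_disk"
  by (induction I rule: infinite_finite_induct) (auto intro: L2_disk_add L2_disk_zero)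

lemma L2_disk_cong:
  assumes "\<And>z. z \<in> unit_disk \<Longrightarrow> f z = g z"
  shows "f \<in> L2_disk \<longleftrightarrow> g \<in> L2_disk"
proof -
  have "f \<in> borel_measurable disk_area \<longleftrightarrow> g \<in> borel_measurable disk_area"
    by (rule measurable_cong) (use assms in auto)
  moreover have "integrable disk_area (\<lambda>z. (cmod (f z))\<^sup>2) \<longleftrightarrow> integrable disk_area (\<lambda>z. (cmod (g z))\<^sup>2)"
    by (rule Bochner_Integration.integrable_cong) (use assms in auto)
  ultimately show ?thesis by (simp add: L2_disk_def)
qed

lemma L2_inner_cong:
  assumes "\<And>z. z \<in> unit_disk \<Longrightarrow> f z = f' z" "\<And>z. z \<in> unit_disk \<Longrightarrow> g z = g' z"
  shows "L2_inner f g = L2_inner f' g'"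
  unfolding L2_inner_def by (rule Bochner_Integration.integral_cong) (use assms in auto)

lemma borel_measurable_cnj [measurable (raw)]:
  "f \<in> borel_measurable M \<Longrightarrow> (\<lambda>x. cnj (f x)) \<in> borel_measurable M"
  by (rule borel_measurable_continuous_on[of cnj]) (intro continuous_intros)

lemma L2_disk_integrable_mult:
  assumes "f \<in> L2_disk" "g \<in> L2_disk"
  shows "integrable disk_area (\<lambda>z. f z * cnj (g z))"
proof (rule Bochner_Integration.integrable_bound)
  show "integrable disk_area (\<lambda>z. (cmod (f z))\<^sup>2 + (cmod (g z))\<^sup>2)"
    using assms by (auto simp: L2_disk_def)
  have "cmod (f z) * cmod (g z) \<le> (cmod (f z))\<^sup>2 + (cmod (g z))\<^sup>2" for z
  proof -
    have "0 \<le> cmod (f z) * cmod (g z)" by simp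
    then show ?thesis
      using sum_squares_bound[of "cmod (f z)" "cmod (g z)"] by linarith
  qed
  then show "AE z in disk_area. norm (f z * cnj (g z)) \<le> norm ((cmod (f z))\<^sup>2 + (cmod (g z))\<^sup>2)"
    by (intro AE_I2) (simp add: norm_mult)
  show "(\<lambda>z. f z * cnj (g z)) \<in> borel_measurable disk_area"
    using assms by (auto simp: L2_disk_def)
qed

lemma L2_inner_add_left:
  "f \<in> L2_disk \<Longrightarrow> g \<in> L2_disk \<Longrightarrow> k \<in> L2_disk \<Longrightarrow>
    L2_inner (\<lambda>z. f z + g z) k = L2_inner f k + L2_inner g k"
  by (simp add: L2_inner_def distrib_right L2_disk_integrable_mult)

lemma L2_inner_diff_left:
  "f \<in> L2_disk \<Longrightarrow> g \<in> L2_disk \<Longrightarrow> k \<in> L2_disk \<Longrightarrow>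
    L2_inner (\<lambda>z. f z - g z) k = L2_inner f k - L2_inner g k"
  by (simp add: L2_inner_def left_diff_distrib L2_disk_integrable_mult)

lemma L2_inner_cmult_left: "L2_inner (\<lambda>z. c * f z) k = c * L2_inner f k"
  by (simp add: L2_inner_def mult.assoc)

lemma L2_inner_cnj: "cnj (L2_inner f g) = L2_inner g f"
proof -
  have "cnj (L2_inner f g) = (LINT z|disk_area. cnj (f z * cnj (g z)))"
    unfolding L2_inner_def by (rule Bochner_Integration.integral_cnj[symmetric])
  then show ?thesis by (simp add: L2_inner_def mult.commute)
qed

lemma L2_inner_cmult_right: "L2_inner f (\<lambda>z. c * k z) = cnj c * L2_inner f k"
  using arg_cong[OF L2_inner_cmult_left[of c k f], where f = cnj] by (simp add: L2_inner_cnj)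

lemma L2_inner_diff_right:
  "f \<in> L2_disk \<Longrightarrow> g \<in> L2_disk \<Longrightarrow> k \<in> L2_disk \<Longrightarrow>
    L2_inner k (\<lambda>z. f z - g z) = L2_inner k f - L2_inner k g"
  using arg_cong[OF L2_inner_diff_left[of f g k], where f = cnj] by (simp add: L2_inner_cnj)

lemma L2_inner_sum_left:
  "(\<And>i. i \<in> I \<Longrightarrow> f i \<in> L2_disk) \<Longrightarrow> k \<in> L2_disk \<Longrightarrow>
    L2_inner (\<lambda>z. \<Sum>i\<in>I. f i z) k = (\<Sum>i\<in>I. L2_inner (f i) k)"
  by (simp add: L2_inner_def sum_distrib_right L2_disk_integrable_mult Bochner_Integration.integral_sum)

lemma L2_inner_sum_right:
  assumes "\<And>i. i \<in> I \<Longrightarrow> f i \<in> L2_disk" "k \<in> L2_disk"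
  shows "L2_inner k (\<lambda>z. \<Sum>i\<in>I. f i z) = (\<Sum>i\<in>I. L2_inner k (f i))"
  using arg_cong[OF L2_inner_sum_left[OF assms], where f = cnj] by (simp add: L2_inner_cnj)

lemma L2_inner_self: "L2_inner f f = of_real (LINT z|disk_area. (cmod (f z))\<^sup>2)"
  unfolding L2_inner_def by (simp only: complex_norm_square[symmetric] integral_complex_of_real)

text \<open>
  Norm convergence implies weak convergence. The bound used is Young's inequality
  |\<langle>f, g\<rangle>| \<le> s ||f||^2 + ||g||^2 / s, with s chosen small first.
\<close>
lemma L2_inner_tendsto_zero:
  assumes f: "f \<in> L2_disk" and g: "\<And>n. g n \<in> L2_disk"
    and lim: "(\<lambda>n. LINT z|disk_area. (cmod (g n z))\<^sup>2) \<longlonglongrightarrow> 0"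
  shows "(\<lambda>n. L2_inner f (g n)) \<longlonglongrightarrow> 0"
proof (rule LIMSEQ_I)
  define F where "F = (LINT z|disk_area. (cmod (f z))\<^sup>2)"
  define G where "G = (\<lambda>n. LINT z|disk_area. (cmod (g n z))\<^sup>2)"
  have F: "F \<ge> 0" unfolding F_def by simp
  have young: "cmod (L2_inner f (g n)) \<le> s * F + G n / s" if s: "s > 0" for s n
  proof -
    have "cmod (L2_inner f (g n)) \<le> (LINT z|disk_area. cmod (f z) * cmod (g n z))"
      unfolding L2_inner_def by (rule order_trans[OF integral_norm_bound]) (simp add: norm_mult)
    also have "\<dots> \<le> (LINT z|disk_area. s * (cmod (f z))\<^sup>2 + (cmod (g n z))\<^sup>2 / s)"
    proof (rule integral_mono)
      show "integrable disk_area (\<lambda>z. cmod (f z) * cmod (g n z))"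
        using integrable_norm[OF L2_disk_integrable_mult[OF f g[of n]]] by (simp add: norm_mult)
      show "integrable disk_area (\<lambda>z. s * (cmod (f z))\<^sup>2 + (cmod (g n z))\<^sup>2 / s)"
        using f g[of n] by (auto simp: L2_disk_def)
      fix z
      have "0 \<le> (s * cmod (f z) - cmod (g n z))\<^sup>2 + s * cmod (f z) * cmod (g n z)"
        using s by simp
      then show "cmod (f z) * cmod (g n z) \<le> s * (cmod (f z))\<^sup>2 + (cmod (g n z))\<^sup>2 / s"
        using s by (simp add: field_simps power2_eq_square)
    qed
    also have "\<dots> = s * F + G n / s"
      using f g[of n] by (simp add: F_def G_def L2_disk_def)
    finally show ?thesis .
  qed
  fix e :: real assume e: "e > 0"
  \<comment> \<open>The summand 1 keeps s positive and finite when f vanishes.\<close>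
  define s where "s = e / (2 * (F + 1))"
  have s: "s > 0" using e F by (simp add: s_def)
  have sF: "s * F < e / 2"
    using e F by (simp add: s_def field_simps)
  have "0 < s * (e / 2)" using s e by simp
  then obtain N where N: "\<And>n. n \<ge> N \<Longrightarrow> norm (G n - 0) < s * (e / 2)"
    using LIMSEQ_D[OF lim[folded G_def]] by blast
  show "\<exists>N. \<forall>n\<ge>N. norm (L2_inner f (g n) - 0) < e"
  proof (intro exI allI impI)
    fix n assume "n \<ge> N"
    then have "G n < s * (e / 2)" using N[of n] by auto
    then have "G n / s < e / 2" using s by (simp add: field_simps)
    then have "cmod (L2_inner f (g n)) < e"
      using young[OF s, of n] sF by linarith
    then show "norm (L2_inner f (g n) - 0) < e" by simp
  qed
qed



section \<open>Power series in the Bergman space\<close>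

text \<open>
  The monomial z^n as an element of the Bergman space, whose elements vanish outside the disk.
\<close>
definition disk_power :: "nat \<Rightarrow> complex \<Rightarrow> complex" where
  "disk_power n z = (if z \<in> unit_disk then z ^ n else 0)"

definition disk_series :: "(nat \<Rightarrow> complex) \<Rightarrow> complex \<Rightarrow> complex" where
  "disk_series c z = (if z \<in> unit_disk then (\<Sum>n. c n * z ^ n) else 0)"

lemma bergman_spaceI:
  assumes "g \<in> L2_disk" "g holomorphic_on unit_disk" "\<And>z. z \<notin> unit_disk \<Longrightarrow> g z = 0"
  shows "g \<in> bergman_space"
  using assms by (simp add: bergman_space_def)

lemma bergman_spaceD:
  assumes "g \<in> bergman_space"
  shows "g \<in> L2_disk" "g holomorphic_on unit_disk" "\<And>z. z \<notin> unit_disk \<Longrightarrow> g z = 0"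
  using assms by (auto simp: bergman_space_def)

lemma bergman_space_add:
  assumes "f \<in> bergman_space" "g \<in> bergman_space"
  shows "(\<lambda>z. f z + g z) \<in> bergman_space"
  using assms by (auto simp: bergman_space_def intro: L2_disk_add holomorphic_intros)

lemma bergman_space_cmult:
  assumes "f \<in> bergman_space"
  shows "(\<lambda>z. c * f z) \<in> bergman_space"
  using assms by (auto simp: bergman_space_def intro: L2_disk_cmult holomorphic_intros)

lemma bergman_space_sum:
  "(\<And>i. i \<in> I \<Longrightarrow> f i \<in> bergman_space) \<Longrightarrow> (\<lambda>z. \<Sum>i\<in>I. f i z) \<in> bergman_space"
  by (auto simp: bergman_space_def intro!: L2_disk_sum holomorphic_on_sum)

lemma disk_power_bergman: "disk_power n \<in> bergman_space"
proof (rule bergman_spaceI)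
  have "(\<lambda>z. z ^ n) \<in> L2_disk"
  proof (rule L2_diskI_bound)
    show "(\<lambda>z. z ^ n) \<in> borel_measurable disk_area"
      by (rule borel_measurable_disk_area) measurable
    show "integrable disk_area (\<lambda>z. 1::real)" by simp
    show "(cmod (z ^ n))\<^sup>2 \<le> 1" if "z \<in> unit_disk" for z
      using that by (auto simp: norm_power power_le_one)
  qed
  then show "disk_power n \<in> L2_disk"
    by (subst L2_disk_cong[where g = "\<lambda>z. z ^ n"]) (auto simp: disk_power_def)
  have "(\<lambda>z::complex. z ^ n) holomorphic_on unit_disk"
    by (intro holomorphic_intros)
  then show "disk_power n holomorphic_on unit_disk"
    by (rule holomorphic_transform) (auto simp: disk_power_def)
qed (auto simp: disk_power_def)

lemmas disk_power_L2 = bergman_spaceD(1)[OF disk_power_bergman]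

lemma disk_power_sum_L2: "(\<lambda>z. \<Sum>n\<in>F. c n * disk_power n z) \<in> L2_disk"
  by (intro L2_disk_sum L2_disk_cmult disk_power_L2)

lemma L2_inner_disk_power:
  "L2_inner (disk_power m) (disk_power n) = (if m = n then 1 / (of_nat n + 1) else 0)"
proof -
  have "L2_inner (disk_power m) (disk_power n) =
      (LINT z|disk_area. indicator (cball 0 1) z * (z ^ m * cnj z ^ n))"
    unfolding L2_inner_def
    by (rule Bochner_Integration.integral_cong) (auto simp: disk_power_def)
  then show ?thesis by (simp add: disk_moment)
qed

lemma L2_inner_power_sum:
  assumes "finite F"
  shows "L2_inner (\<lambda>z. \<Sum>n\<in>F. c n * disk_power n z) (disk_power m) =
    (if m \<in> F then c m / (of_nat m + 1) else 0)"
  using assms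
  by (simp add: L2_inner_sum_left L2_disk_cmult disk_power_L2 L2_inner_cmult_left L2_inner_disk_power
      if_distrib[of "\<lambda>x. _ * x"] cong: if_cong)

lemma norm_square_power_sum:
  assumes F: "finite F"
  shows "(LINT z|disk_area. (cmod (\<Sum>n\<in>F. c n * disk_power n z))\<^sup>2) =
    (\<Sum>n\<in>F. (cmod (c n))\<^sup>2 / (real n + 1))"
proof -
  let ?s = "\<lambda>z. \<Sum>n\<in>F. c n * disk_power n z"
  have "complex_of_real (LINT z|disk_area. (cmod (?s z))\<^sup>2) = L2_inner ?s ?s"
    by (rule L2_inner_self[symmetric])
  also have "\<dots> = (\<Sum>n\<in>F. cnj (c n) * L2_inner ?s (disk_power n))"
    by (subst L2_inner_sum_right)
       (auto intro: L2_disk_cmult disk_power_L2 disk_power_sum_L2 simp: L2_inner_cmult_right)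
  also have "\<dots> = (\<Sum>n\<in>F. complex_of_real ((cmod (c n))\<^sup>2 / (real n + 1)))"
  proof (rule sum.cong[OF refl])
    fix n assume "n \<in> F"
    then have "cnj (c n) * L2_inner ?s (disk_power n) = (c n * cnj (c n)) / (of_nat n + 1)"
      by (simp add: L2_inner_power_sum[OF F])
    also have "c n * cnj (c n) = of_real ((cmod (c n))\<^sup>2)"
      by (rule complex_norm_square[symmetric])
    finally show "cnj (c n) * L2_inner ?s (disk_power n) = complex_of_real ((cmod (c n))\<^sup>2 / (real n + 1))"
      by simp
  qed
  also have "\<dots> = complex_of_real (\<Sum>n\<in>F. (cmod (c n))\<^sup>2 / (real n + 1))"
    by (rule of_real_sum[symmetric])
  finally show ?thesis by (simp only: of_real_eq_iff)
qed

text \<open>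
  The factor n + 1 is the reciprocal of the squared norm of z^n, so that this is the coefficient of z^n
  in the orthogonal expansion.
\<close>
definition fourier_coeff :: "(complex \<Rightarrow> complex) \<Rightarrow> nat \<Rightarrow> complex" where
  "fourier_coeff f n = (of_nat n + 1) * L2_inner f (disk_power n)"

lemma fourier_coeff_eq: "L2_inner f (disk_power n) = fourier_coeff f n / (of_nat n + 1)"
proof -
  have "(of_nat n + 1 :: complex) \<noteq> 0"
    by (metis of_nat_Suc of_nat_eq_0_iff add.commute nat.distinct(1))
  then show ?thesis by (simp add: fourier_coeff_def)
qed

lemma bessel_inequality:
  assumes f: "f \<in> L2_disk" and F: "finite F"
  shows "(\<Sum>n\<in>F. (cmod (fourier_coeff f n))\<^sup>2 / (real n + 1)) \<le> (LINT z|disk_area. (cmod (f z))\<^sup>2)"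
proof -
  define c where "c = fourier_coeff f"
  let ?s = "\<lambda>z. \<Sum>n\<in>F. c n * disk_power n z"
  define S where "S = (\<Sum>n\<in>F. (cmod (c n))\<^sup>2 / (real n + 1))"
  have s: "?s \<in> L2_disk" by (rule disk_power_sum_L2)
  have "L2_inner f ?s = (\<Sum>n\<in>F. cnj (c n) * L2_inner f (disk_power n))"
    using f by (subst L2_inner_sum_right)
       (auto intro: L2_disk_cmult disk_power_L2 simp: L2_inner_cmult_right)
  also have "\<dots> = (\<Sum>n\<in>F. complex_of_real ((cmod (c n))\<^sup>2 / (real n + 1)))"
  proof (rule sum.cong[OF refl])
    fix n
    have "cnj (c n) * L2_inner f (disk_power n) = (c n * cnj (c n)) / (of_nat n + 1)"
      by (simp add: fourier_coeff_eq c_def)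
    also have "c n * cnj (c n) = of_real ((cmod (c n))\<^sup>2)"
      by (rule complex_norm_square[symmetric])
    finally show "cnj (c n) * L2_inner f (disk_power n) = complex_of_real ((cmod (c n))\<^sup>2 / (real n + 1))"
      by simp
  qed
  also have "\<dots> = of_real S"
    unfolding S_def by (rule of_real_sum[symmetric])
  finally have fs: "L2_inner f ?s = of_real S" .
  have sf: "L2_inner ?s f = of_real S"
    using arg_cong[OF fs, where f = cnj] by (simp only: L2_inner_cnj complex_cnj_complex_of_real)
  have ss: "L2_inner ?s ?s = of_real S"
    unfolding L2_inner_self norm_square_power_sum[OF F] S_def ..
  have "complex_of_real (LINT z|disk_area. (cmod (f z - ?s z))\<^sup>2) = L2_inner (\<lambda>z. f z - ?s z) (\<lambda>z. f z - ?s z)"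
    by (rule L2_inner_self[symmetric])
  also have "\<dots> = L2_inner f f - L2_inner f ?s - (L2_inner ?s f - L2_inner ?s ?s)"
    using f s by (simp add: L2_inner_diff_left L2_inner_diff_right L2_disk_diff)
  also have "\<dots> = of_real ((LINT z|disk_area. (cmod (f z))\<^sup>2) - S)"
    by (simp add: fs sf ss L2_inner_self)
  finally have "(LINT z|disk_area. (cmod (f z - ?s z))\<^sup>2) = (LINT z|disk_area. (cmod (f z))\<^sup>2) - S"
    by (simp only: of_real_eq_iff)
  moreover have "0 \<le> (LINT z|disk_area. (cmod (f z - ?s z))\<^sup>2)" by simp
  ultimately show ?thesis by (simp add: S_def c_def)
qed

lemma fourier_coeff_summable:
  assumes "f \<in> L2_disk"
  shows "summable (\<lambda>n. (cmod (fourier_coeff f n))\<^sup>2 / (real n + 1))"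
  by (rule summableI_nonneg_bounded[where x = "LINT z|disk_area. (cmod (f z))\<^sup>2"])
     (auto intro: bessel_inequality[OF assms])

context
  fixes c :: "nat \<Rightarrow> complex"
  assumes c: "summable (\<lambda>n. (cmod (c n))\<^sup>2 / (real n + 1))"
begin

lemma disk_series_summable:
  assumes z: "z \<in> unit_disk"
  shows "summable (\<lambda>n. c n * z ^ n)"
proof -
  define S where "S = (\<Sum>n. (cmod (c n))\<^sup>2 / (real n + 1))"
  have S: "(cmod (c n))\<^sup>2 / (real n + 1) \<le> S" for n
    unfolding S_def using sum_le_suminf[OF c, of "{n}"] by simp
  have bound: "cmod (c n) \<le> (S + 1) * (real n + 1)" for n
  proof -
    have "cmod (c n) \<le> (cmod (c n))\<^sup>2 + 1"
      using sum_squares_bound[of "cmod (c n)" 1] norm_ge_zero[of "c n"]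
      unfolding power_one mult_1_right by linarith
    also have "\<dots> \<le> S * (real n + 1) + 1"
      using S[of n] by (simp add: field_simps)
    also have "\<dots> \<le> (S + 1) * (real n + 1)"
      by (simp add: algebra_simps)
    finally show ?thesis .
  qed
  have "summable (\<lambda>n. (real n + 1) * cmod z ^ n)"
    using geometric_deriv_sums[of "cmod z"] z by (auto simp: sums_iff add.commute)
  then have "summable (\<lambda>n. (S + 1) * ((real n + 1) * cmod z ^ n))"
    by (rule summable_mult)
  then show ?thesis
  proof (rule summable_comparison_test')
    show "norm (c n * z ^ n) \<le> (S + 1) * ((real n + 1) * cmod z ^ n)" for n
      using mult_right_mono[OF bound[of n], of "cmod z ^ n"]
      by (simp add: norm_mult norm_power mult.assoc)
  qed
qed

lemma disk_series_sums:
  assumes "z \<in> unit_disk"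
  shows "(\<lambda>n. c n * disk_power n z) sums disk_series c z"
  using summable_sums[OF disk_series_summable[OF assms]] assms
  by (simp add: disk_power_def disk_series_def)

lemma disk_series_holomorphic: "disk_series c holomorphic_on unit_disk"
proof (rule power_series_holomorphic)
  show "(\<lambda>n. c n * (w - 0) ^ n) sums disk_series c w" if "w \<in> unit_disk" for w
    using disk_series_sums[OF that] that by (simp add: disk_power_def)
qed

text \<open>
  The tail is the pointwise limit of finite sums of orthogonal monomials, whose norms are known, so
  Fatou's lemma bounds its norm by the tail of the numerical series. This yields square integrability
  of the sum (for M = 0) and norm convergence of the partial sums at once.
\<close>
lemma disk_series_tail:
  defines "r \<equiv> \<lambda>M z. disk_series c z - (\<Sum>n<M. c n * disk_power n z)"
  shows disk_series_tail_L2: "r M \<in> L2_disk"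
    and disk_series_tail_norm: "(LINT z|disk_area. (cmod (r M z))\<^sup>2) \<le> (\<Sum>n. (cmod (c (n + M)))\<^sup>2 / (real (n + M) + 1))"
proof -
  define T where "T = (\<Sum>n. (cmod (c (n + M)))\<^sup>2 / (real (n + M) + 1))"
  define d where "d = (\<lambda>N z. \<Sum>n\<in>{M..<N}. c n * disk_power n z)"
  have T0: "T \<ge> 0"
    unfolding T_def using summable_ignore_initial_segment[OF c, of M] by (intro suminf_nonneg) auto
  have meas: "r M \<in> borel_measurable disk_area"
    unfolding r_def
    using L2_diskD(1)[OF disk_power_sum_L2[of c "{..<M}"]]
      borel_measurable_disk_area_continuous[OF holomorphic_on_imp_continuous_on[OF disk_series_holomorphic]]
    by simp
  have dL2: "d N \<in> L2_disk" for N unfolding d_def by (rule disk_power_sum_L2)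
  have d_norm: "(\<integral>\<^sup>+z. ennreal ((cmod (d N z))\<^sup>2) \<partial>disk_area) \<le> ennreal T" for N
  proof -
    have "(\<integral>\<^sup>+z. ennreal ((cmod (d N z))\<^sup>2) \<partial>disk_area) = ennreal (LINT z|disk_area. (cmod (d N z))\<^sup>2)"
      using L2_diskD(2)[OF dL2] by (intro nn_integral_eq_integral) auto
    also have "(LINT z|disk_area. (cmod (d N z))\<^sup>2) = (\<Sum>n\<in>{M..<N}. (cmod (c n))\<^sup>2 / (real n + 1))"
      unfolding d_def by (rule norm_square_power_sum) simp
    also have "\<dots> = (\<Sum>n<N-M. (cmod (c (n + M)))\<^sup>2 / (real (n + M) + 1))"
      by (rule sum.reindex_bij_witness[of _ "\<lambda>n. n + M" "\<lambda>n. n - M"]) auto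
    also have "ennreal \<dots> \<le> ennreal T"
      unfolding T_def
      using sum_le_suminf[OF summable_ignore_initial_segment[OF c, of M], of "{..<N-M}"] by (intro ennreal_leI) auto
    finally show ?thesis .
  qed
  have lim: "(\<lambda>N. d N z) \<longlonglongrightarrow> r M z" if z: "z \<in> unit_disk" for z
  proof -
    have "(\<lambda>N. (\<Sum>n<N. c n * disk_power n z) - (\<Sum>n<M. c n * disk_power n z)) \<longlonglongrightarrow> r M z"
      unfolding r_def using disk_series_sums[OF z] by (intro tendsto_diff) (auto simp: sums_def)
    moreover have "\<forall>\<^sub>F N in sequentially. (\<Sum>n<N. c n * disk_power n z) - (\<Sum>n<M. c n * disk_power n z) = d N z"
      using eventually_ge_at_top[of M]
    proof eventually_elim
      case (elim N)
      then have "{..<N} = {..<M} \<union> {M..<N}" by auto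
      then have "(\<Sum>n<N. c n * disk_power n z) = (\<Sum>n<M. c n * disk_power n z) + d N z"
        unfolding d_def by (simp add: sum.union_disjoint ivl_disj_int)
      then show ?case by simp
    qed
    ultimately show ?thesis by (rule Lim_transform_eventually)
  qed
  have "(\<integral>\<^sup>+z. ennreal ((cmod (r M z))\<^sup>2) \<partial>disk_area) =
      (\<integral>\<^sup>+z. liminf (\<lambda>N. ennreal ((cmod (d N z))\<^sup>2)) \<partial>disk_area)"
  proof (rule nn_integral_cong)
    fix z assume "z \<in> space disk_area"
    then have "(\<lambda>N. ennreal ((cmod (d N z))\<^sup>2)) \<longlonglongrightarrow> ennreal ((cmod (r M z))\<^sup>2)"
      by (intro tendsto_ennrealI tendsto_intros lim) simp
    then show "ennreal ((cmod (r M z))\<^sup>2) = liminf (\<lambda>N. ennreal ((cmod (d N z))\<^sup>2))"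
      by (rule lim_imp_Liminf[OF trivial_limit_sequentially, symmetric])
  qed
  also have "\<dots> \<le> liminf (\<lambda>N. \<integral>\<^sup>+z. ennreal ((cmod (d N z))\<^sup>2) \<partial>disk_area)"
    by (rule nn_integral_liminf)
       (rule measurable_compose[OF borel_measurable_integrable[OF L2_diskD(2)[OF dL2]] measurable_ennreal])
  also have "\<dots> \<le> ennreal T"
    by (rule Liminf_le) (use d_norm in auto)
  finally have le: "(\<integral>\<^sup>+z. ennreal ((cmod (r M z))\<^sup>2) \<partial>disk_area) \<le> ennreal T" .
  have int: "integrable disk_area (\<lambda>z. (cmod (r M z))\<^sup>2)"
    using le meas by (intro integrableI_nonneg) (auto simp: less_top[symmetric] top_unique)
  then show "r M \<in> L2_disk"
    using meas by (simp add: L2_disk_def)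
  have "ennreal (LINT z|disk_area. (cmod (r M z))\<^sup>2) \<le> ennreal T"
    using le int by (subst nn_integral_eq_integral[symmetric]) auto
  then show "(LINT z|disk_area. (cmod (r M z))\<^sup>2) \<le> (\<Sum>n. (cmod (c (n + M)))\<^sup>2 / (real (n + M) + 1))"
    using T0 by (simp add: T_def)
qed

lemma disk_series_bergman: "disk_series c \<in> bergman_space"
proof (rule bergman_spaceI)
  show "disk_series c \<in> L2_disk"
    using disk_series_tail_L2[of 0] by simp
qed (simp_all add: disk_series_holomorphic, simp add: disk_series_def)

lemma disk_series_partial_sums_converge:
  "(\<lambda>M. LINT z|disk_area. (cmod (disk_series c z - (\<Sum>n<M. c n * disk_power n z)))\<^sup>2) \<longlonglongrightarrow> 0"
proof (rule tendsto_sandwich[OF _ _ tendsto_const])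
  show "(\<lambda>M. \<Sum>n. (cmod (c (n + M)))\<^sup>2 / (real (n + M) + 1)) \<longlonglongrightarrow> 0"
    by (rule suminf_exist_split2[OF c])
qed (use disk_series_tail_norm in auto)

lemma L2_inner_disk_series: "L2_inner (disk_series c) (disk_power m) = c m / (of_nat m + 1)"
proof -
  let ?r = "\<lambda>M z. disk_series c z - (\<Sum>n<M. c n * disk_power n z)"
  have "(\<lambda>M. L2_inner (disk_power m) (?r M)) \<longlonglongrightarrow> 0"
    by (rule L2_inner_tendsto_zero[OF disk_power_L2 disk_series_tail_L2 disk_series_partial_sums_converge])
  then have "(\<lambda>M. cnj (L2_inner (disk_power m) (?r M))) \<longlonglongrightarrow> cnj 0"
    by (rule tendsto_cnj)
  then have "(\<lambda>M. L2_inner (?r M) (disk_power m)) \<longlonglongrightarrow> 0"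
    by (simp add: L2_inner_cnj)
  moreover have "\<forall>\<^sub>F M in sequentially.
      L2_inner (?r M) (disk_power m) = L2_inner (disk_series c) (disk_power m) - c m / (of_nat m + 1)"
    using eventually_gt_at_top[of m]
  proof eventually_elim
    case (elim M)
    then show ?case
      by (simp add: L2_inner_diff_left disk_power_L2 disk_power_sum_L2 L2_inner_power_sum
          bergman_spaceD(1)[OF disk_series_bergman])
  qed
  ultimately have "(\<lambda>M::nat. L2_inner (disk_series c) (disk_power m) - c m / (of_nat m + 1)) \<longlonglongrightarrow> 0"
    by (rule Lim_transform_eventually)
  then show ?thesis by (simp add: LIMSEQ_const_iff)
qed

end



text \<open>
  On the closed disk of radius r < 1 the Taylor series converges absolutely and uniformly, so it can be
  integrated term by term; only the term n = m survives.
\<close>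
lemma bergman_disk_moment:
  assumes k: "k \<in> bergman_space" and r: "0 \<le> r" "r < 1"
  defines "a \<equiv> \<lambda>n. (deriv ^^ n) k 0 / fact n"
  shows "(LINT z|disk_area. indicator (cball 0 r) z * (k z * cnj z ^ m)) =
    a m * of_real (r ^ (2 * m + 2) / (real m + 1))"
proof -
  have sums: "(\<lambda>n. a n * z ^ n) sums k z" if "z \<in> unit_disk" for z
    using holomorphic_power_series[OF bergman_spaceD(2)[OF k] that] by (simp add: a_def)
  define f where "f = (\<lambda>n z. indicator (cball 0 r) z * (a n * z ^ n * cnj z ^ m))"
  have f_bound: "norm (f n z) \<le> cmod (a n) * r ^ n" if "z \<in> unit_disk" for n z
  proof (cases "z \<in> cball 0 r")
    case True
    have "cmod (a n) * cmod z ^ n * cmod z ^ m \<le> cmod (a n) * r ^ n * 1"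
      using that True r by (intro mult_mono power_mono power_le_one) auto
    then show ?thesis using True by (simp add: f_def norm_mult norm_power)
  qed (use r in \<open>simp add: f_def\<close>)
  have bound_summable: "summable (\<lambda>n. cmod (a n) * r ^ n)"
  proof -
    \<comment> \<open>Absolute convergence at r follows from convergence at a point strictly between r and 1.\<close>
    define \<rho> where "\<rho> = (r + 1) / 2"
    have "summable (\<lambda>n. norm (a n * of_real r ^ n))"
    proof (rule powser_insidea)
      show "summable (\<lambda>n. a n * of_real \<rho> ^ n)"
        using sums[of "of_real \<rho>"] r by (auto simp: \<rho>_def sums_iff)
      show "norm (complex_of_real r) < norm (complex_of_real \<rho>)"
        using r by (simp add: \<rho>_def)
    qed
    then show ?thesis using r by (simp add: norm_mult norm_power)
  qed
  have f_meas: "f n \<in> borel_measurable disk_area" for n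
    unfolding f_def
    by (intro borel_measurable_disk_area borel_measurable_times borel_measurable_indicator
        borel_measurable_continuous_onI continuous_intros) auto
  have f_int: "integrable disk_area (f n)" for n
    by (rule Bochner_Integration.integrable_bound[where f = "\<lambda>_. cmod (a n) * r ^ n"])
       (use f_meas f_bound r in \<open>auto intro!: AE_I2\<close>)
  have f_integral: "integral\<^sup>L disk_area (f n) =
      (if n = m then a m * of_real (r ^ (2 * m + 2) / (real m + 1)) else 0)" for n
  proof -
    have "f n = (\<lambda>z. a n * (indicator (cball 0 r) z * (z ^ n * cnj z ^ m)))"
      by (simp add: f_def fun_eq_iff mult_ac)
    then have "integral\<^sup>L disk_area (f n) = a n * (LINT z|disk_area. indicator (cball 0 r) z * (z ^ n * cnj z ^ m))"
      by simp
    then show ?thesis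
      using disk_moment[of r n m] r by simp
  qed
  have "(LINT z|disk_area. indicator (cball 0 r) z * (k z * cnj z ^ m)) = (LINT z|disk_area. (\<Sum>n. f n z))"
  proof (rule Bochner_Integration.integral_cong[OF refl])
    fix z assume "z \<in> space disk_area"
    then have "(\<lambda>n. indicator (cball 0 r) z * cnj z ^ m * (a n * z ^ n)) sums (indicator (cball 0 r) z * cnj z ^ m * k z)"
      by (intro sums_mult sums) simp
    then show "indicator (cball 0 r) z * (k z * cnj z ^ m) = (\<Sum>n. f n z)"
      by (simp add: f_def sums_iff mult_ac)
  qed
  also have "\<dots> = (\<Sum>n. integral\<^sup>L disk_area (f n))"
  proof (rule integral_suminf[OF f_int])
    show "AE z in disk_area. summable (\<lambda>n. norm (f n z))"
      by (intro AE_I2 summable_comparison_test'[OF bound_summable, of 0]) (use f_bound in auto)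
    show "summable (\<lambda>n. LINT z|disk_area. norm (f n z))"
    proof (rule summable_comparison_test'[OF bound_summable, of 0])
      fix n
      have "(LINT z|disk_area. norm (f n z)) \<le> (LINT z|disk_area. cmod (a n) * r ^ n)"
        using f_bound f_int by (intro integral_mono) auto
      also have "\<dots> = cmod (a n) * r ^ n"
        using emeasure_disk_area_ball[of 1] by (simp add: measure_def)
      finally show "norm (LINT z|disk_area. norm (f n z)) \<le> cmod (a n) * r ^ n" by simp
    qed
  qed
  also have "\<dots> = a m * of_real (r ^ (2 * m + 2) / (real m + 1))"
    unfolding f_integral by (subst suminf_finite[of "{m}"]) auto
  finally show ?thesis .
qed

text \<open>
  Dominated convergence as the radius tends to 1, which turns the moments over smaller disks into an
  inner product. Its consequence is that the orthogonal expansion of an element of the Bergman space is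
  its Taylor series, that is, the monomials are complete.
\<close>
lemma fourier_coeff_taylor:
  assumes k: "k \<in> bergman_space"
  shows "fourier_coeff k m = (deriv ^^ m) k 0 / fact m"
proof -
  define a where "a = (deriv ^^ m) k 0 / fact m"
  define r where "r = (\<lambda>j::nat. 1 - 1 / (real j + 2))"
  have r: "0 \<le> r j" "r j < 1" for j by (auto simp: r_def)
  have r_lim: "r \<longlonglongrightarrow> 1" unfolding r_def by real_asymp
  have one: "(\<lambda>_. 1) \<in> L2_disk" by (simp add: L2_disk_def)
  have "(\<lambda>j. LINT z|disk_area. indicator (cball 0 (r j)) z * (k z * cnj z ^ m))
      \<longlonglongrightarrow> (LINT z|disk_area. k z * cnj z ^ m)"
  proof (rule integral_dominated_convergence)
    show "integrable disk_area (\<lambda>z. norm (k z * cnj 1))"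
      by (rule integrable_norm[OF L2_disk_integrable_mult[OF bergman_spaceD(1)[OF k] one]])
    have k_meas: "k \<in> borel_measurable disk_area"
      by (rule L2_diskD(1)[OF bergman_spaceD(1)[OF k]])
    have p_meas: "(\<lambda>z. cnj z ^ m) \<in> borel_measurable disk_area"
      by (intro borel_measurable_disk_area borel_measurable_continuous_onI continuous_intros)
    have i_meas: "(indicator (cball 0 (r j)) :: complex \<Rightarrow> complex) \<in> borel_measurable disk_area" for j
      by (intro borel_measurable_disk_area borel_measurable_indicator) auto
    show "(\<lambda>z. k z * cnj z ^ m) \<in> borel_measurable disk_area"
      by (rule borel_measurable_times[OF k_meas p_meas])
    show "(\<lambda>z. indicator (cball 0 (r j)) z * (k z * cnj z ^ m)) \<in> borel_measurable disk_area" for j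
      by (rule borel_measurable_times[OF i_meas borel_measurable_times[OF k_meas p_meas]])
    show "AE z in disk_area. norm (indicator (cball 0 (r j)) z * (k z * cnj z ^ m)) \<le> norm (k z * cnj 1)" for j
    proof (rule AE_I2)
      fix z assume "z \<in> space disk_area"
      then have "cmod z ^ m \<le> 1" by (simp add: power_le_one)
      then show "norm (indicator (cball 0 (r j)) z * (k z * cnj z ^ m)) \<le> norm (k z * cnj 1)"
        using mult_left_mono[of "cmod z ^ m" 1 "cmod (k z)"]
        by (auto simp: norm_mult norm_power indicator_def)
    qed
    show "AE z in disk_area. (\<lambda>j. indicator (cball 0 (r j)) z * (k z * cnj z ^ m)) \<longlonglongrightarrow> k z * cnj z ^ m"
    proof (rule AE_I2)
      fix z assume "z \<in> space disk_area"
      then have "\<forall>\<^sub>F j in sequentially. cmod z < r j"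
        by (intro order_tendstoD[OF r_lim]) simp
      then have "\<forall>\<^sub>F j in sequentially. k z * cnj z ^ m = indicator (cball 0 (r j)) z * (k z * cnj z ^ m)"
        by eventually_elim simp
      then show "(\<lambda>j. indicator (cball 0 (r j)) z * (k z * cnj z ^ m)) \<longlonglongrightarrow> k z * cnj z ^ m"
        by (rule Lim_transform_eventually[OF tendsto_const])
    qed
  qed
  moreover have "(LINT z|disk_area. k z * cnj z ^ m) = L2_inner k (disk_power m)"
    unfolding L2_inner_def by (rule Bochner_Integration.integral_cong) (auto simp: disk_power_def)
  ultimately have "(\<lambda>j. a * of_real (r j ^ (2 * m + 2) / (real m + 1))) \<longlonglongrightarrow> L2_inner k (disk_power m)"
    using bergman_disk_moment[OF k r] by (simp add: a_def)
  moreover have "(\<lambda>j. a * of_real (r j ^ (2 * m + 2) / (real m + 1))) \<longlonglongrightarrow> a * of_real (1 ^ (2 * m + 2) / (real m + 1))"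
    by (intro tendsto_intros r_lim) simp
  ultimately have "L2_inner k (disk_power m) = a * of_real (1 ^ (2 * m + 2) / (real m + 1))"
    by (rule LIMSEQ_unique)
  then have "(of_nat m + 1) * L2_inner k (disk_power m) = a * ((of_nat m + 1) / (of_nat m + 1))"
    by simp
  also have "(of_nat m + 1) / (of_nat m + 1) = (1::complex)"
    by (rule divide_self) (metis of_nat_Suc of_nat_eq_0_iff add.commute nat.distinct(1))
  finally show ?thesis by (simp add: fourier_coeff_def a_def)
qed

lemma bergman_eq_disk_series:
  assumes k: "k \<in> bergman_space"
  shows "k = disk_series (fourier_coeff k)"
proof
  fix z
  show "k z = disk_series (fourier_coeff k) z"
  proof (cases "z \<in> unit_disk")
    case True
    then show ?thesis
      using sums_unique[OF holomorphic_power_series[OF bergman_spaceD(2)[OF k] True]]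
      by (simp add: disk_series_def fourier_coeff_taylor[OF k])
  qed (use bergman_spaceD(3)[OF k] in \<open>auto simp: disk_series_def\<close>)
qed

lemma bergman_eqI:
  assumes "f \<in> bergman_space" "g \<in> bergman_space"
    and "\<And>n. L2_inner f (disk_power n) = L2_inner g (disk_power n)"
  shows "f = g"
proof -
  have "f = disk_series (fourier_coeff f)"
    by (rule bergman_eq_disk_series[OF assms(1)])
  also have "fourier_coeff f = fourier_coeff g"
    using assms(3) by (simp add: fourier_coeff_def fun_eq_iff)
  also have "disk_series (fourier_coeff g) = g"
    by (rule bergman_eq_disk_series[OF assms(2), symmetric])
  finally show ?thesis .
qed

text \<open>
  The Taylor polynomials of k converge to k in norm, and f is orthogonal to each of them.
\<close>
lemma L2_inner_eq_zero_bergman: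
  assumes f: "f \<in> L2_disk" and ortho: "\<And>n. L2_inner f (disk_power n) = 0" and k: "k \<in> bergman_space"
  shows "L2_inner f k = 0"
proof -
  let ?c = "fourier_coeff k"
  let ?s = "\<lambda>M z. \<Sum>n<M. ?c n * disk_power n z"
  have c: "summable (\<lambda>n. (cmod (?c n))\<^sup>2 / (real n + 1))"
    by (rule fourier_coeff_summable[OF bergman_spaceD(1)[OF k]])
  have tail: "(\<lambda>z. k z - ?s M z) \<in> L2_disk" for M
    by (intro L2_disk_diff disk_power_sum_L2 bergman_spaceD(1)[OF k])
  have "(\<lambda>M. LINT z|disk_area. (cmod (k z - ?s M z))\<^sup>2) \<longlonglongrightarrow> 0"
    using disk_series_partial_sums_converge[OF c] unfolding bergman_eq_disk_series[OF k, symmetric] .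
  then have "(\<lambda>M. L2_inner f (\<lambda>z. k z - ?s M z)) \<longlonglongrightarrow> 0"
    by (rule L2_inner_tendsto_zero[OF f tail])
  moreover have "L2_inner f (\<lambda>z. k z - ?s M z) = L2_inner f k" for M
  proof -
    have "L2_inner f (?s M) = 0"
      using f by (subst L2_inner_sum_right)
        (auto intro: L2_disk_cmult disk_power_L2 simp: L2_inner_cmult_right ortho)
    then show ?thesis
      using f k by (simp add: L2_inner_diff_right disk_power_sum_L2 bergman_spaceD(1))
  qed
  ultimately show ?thesis by (simp add: LIMSEQ_const_iff)
qed

section \<open>Bergman projection and Toeplitz operators\<close>

lemma bergman_proj_eqI:
  assumes f: "f \<in> L2_disk" and h: "h \<in> bergman_space"
    and eq: "\<And>n. L2_inner h (disk_power n) = L2_inner f (disk_power n)"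
  shows "bergman_proj f = h"
  unfolding bergman_proj_def
proof (rule the_equality)
  show "h \<in> bergman_space \<and> (\<forall>k\<in>bergman_space. L2_inner (\<lambda>z. f z - h z) k = 0)"
  proof (intro conjI ballI)
    fix k assume k: "k \<in> bergman_space"
    note hL2 = bergman_spaceD(1)[OF h]
    have "L2_inner (\<lambda>z. f z - h z) (disk_power n) = 0" for n
      by (simp only: L2_inner_diff_left[OF f hL2 disk_power_L2] eq diff_self)
    then show "L2_inner (\<lambda>z. f z - h z) k = 0"
      by (rule L2_inner_eq_zero_bergman[OF L2_disk_diff[OF f hL2] _ k])
  qed (rule h)
next
  fix h' assume h': "h' \<in> bergman_space \<and> (\<forall>k\<in>bergman_space. L2_inner (\<lambda>z. f z - h' z) k = 0)"
  show "h' = h"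
  proof (rule bergman_eqI)
    fix n
    have h'L2: "h' \<in> L2_disk"
      using h' by (blast intro: bergman_spaceD(1))
    have "L2_inner (\<lambda>z. f z - h' z) (disk_power n) = 0"
      using h' disk_power_bergman by blast
    then show "L2_inner h' (disk_power n) = L2_inner h (disk_power n)"
      by (simp only: L2_inner_diff_left[OF f h'L2 disk_power_L2] eq right_minus_eq)
  qed (use h h' in blast)+
qed

proposition bergman_proj_eq_series:
  assumes "f \<in> L2_disk"
  shows "bergman_proj f = disk_series (fourier_coeff f)"
  by (rule bergman_proj_eqI[OF assms disk_series_bergman[OF fourier_coeff_summable[OF assms]]])
     (simp only: L2_inner_disk_series[OF fourier_coeff_summable[OF assms]] fourier_coeff_eq[of f])

lemma bergman_proj_bergman: "f \<in> L2_disk \<Longrightarrow> bergman_proj f \<in> bergman_space"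
  by (simp add: bergman_proj_eq_series disk_series_bergman fourier_coeff_summable)

lemma L2_inner_bergman_proj:
  assumes f: "f \<in> L2_disk" and k: "k \<in> bergman_space"
  shows "L2_inner (bergman_proj f) k = L2_inner f k"
proof -
  have pf: "bergman_proj f \<in> L2_disk"
    by (rule bergman_spaceD(1)[OF bergman_proj_bergman[OF f]])
  have "L2_inner (\<lambda>z. f z - bergman_proj f z) k = 0"
  proof (rule L2_inner_eq_zero_bergman[OF L2_disk_diff[OF f pf] _ k])
    fix n
    have "L2_inner (bergman_proj f) (disk_power n) = L2_inner f (disk_power n)"
      by (simp only: bergman_proj_eq_series[OF f] L2_inner_disk_series[OF fourier_coeff_summable[OF f]] fourier_coeff_eq[of f])
    then show "L2_inner (\<lambda>z. f z - bergman_proj f z) (disk_power n) = 0"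
      by (simp only: L2_inner_diff_left[OF f pf disk_power_L2] diff_self)
  qed
  then show ?thesis
    by (simp only: L2_inner_diff_left[OF f pf bergman_spaceD(1)[OF k]] right_minus_eq)
qed

text \<open>
  When h is a polynomial, Parseval's identity is a finite sum. This is the case for the images of
  monomials under the operators considered below, which avoids infinite matrix products.
\<close>
lemma bergman_parseval:
  assumes g: "g \<in> bergman_space" and h: "h \<in> bergman_space"
    and fin: "\<And>j. j > J \<Longrightarrow> L2_inner h (disk_power j) = 0"
  shows "L2_inner g h = (\<Sum>j\<le>J. (of_nat j + 1) * L2_inner g (disk_power j) * cnj (L2_inner h (disk_power j)))"
proof -
  let ?p = "\<lambda>z. \<Sum>j\<le>J. fourier_coeff h j * disk_power j z"
  have "h = ?p"
  proof (rule bergman_eqI[OF h])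
    show "?p \<in> bergman_space"
      by (intro bergman_space_sum bergman_space_cmult disk_power_bergman)
    fix n
    have "L2_inner ?p (disk_power n) = (if n \<in> {..J} then fourier_coeff h n / (of_nat n + 1) else 0)"
      by (rule L2_inner_power_sum) simp
    then show "L2_inner h (disk_power n) = L2_inner ?p (disk_power n)"
      using fin[of n] fourier_coeff_eq[of h n] by (cases "n \<le> J") auto
  qed
  then have "L2_inner g h = L2_inner g ?p" by (rule arg_cong)
  also have "\<dots> = (\<Sum>j\<le>J. cnj (fourier_coeff h j) * L2_inner g (disk_power j))"
    using g by (subst L2_inner_sum_right)
      (auto intro: L2_disk_cmult disk_power_L2 bergman_spaceD(1) simp: L2_inner_cmult_right)
  finally show ?thesis by (simp add: fourier_coeff_def mult_ac)
qed

definition bounded_symbol :: "(complex \<Rightarrow> complex) \<Rightarrow> bool" where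
  "bounded_symbol u \<longleftrightarrow> u \<in> borel_measurable disk_area \<and> (\<exists>B. \<forall>z\<in>unit_disk. cmod (u z) \<le> B)"

lemma bounded_symbol_continuous:
  assumes "continuous_on (cball 0 1) u"
  shows "bounded_symbol u"
proof -
  have "bounded (u ` cball 0 1)"
    using assms by (intro compact_imp_bounded compact_continuous_image) auto
  then obtain B where "\<And>z. z \<in> cball 0 1 \<Longrightarrow> cmod (u z) \<le> B"
    unfolding bounded_iff by blast
  then have "\<forall>z\<in>unit_disk. cmod (u z) \<le> B" by simp
  moreover have "u \<in> borel_measurable disk_area"
    by (rule borel_measurable_disk_area_continuous, rule continuous_on_subset[OF assms]) auto
  ultimately show ?thesis by (auto simp: bounded_symbol_def)
qed

lemma bounded_symbol_cnj: "bounded_symbol u \<Longrightarrow> bounded_symbol (\<lambda>z. cnj (u z))"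
  by (auto simp: bounded_symbol_def intro: borel_measurable_cnj)

lemma bounded_symbol_mult_L2: "bounded_symbol u \<Longrightarrow> g \<in> L2_disk \<Longrightarrow> (\<lambda>z. u z * g z) \<in> L2_disk"
  by (auto simp: bounded_symbol_def intro: L2_disk_bounded_mult)

context
  fixes u assumes u: "bounded_symbol u"
begin

lemma symbol_times_bergman_L2: "g \<in> bergman_space \<Longrightarrow> (\<lambda>z. u z * g z) \<in> L2_disk"
  by (rule bounded_symbol_mult_L2[OF u bergman_spaceD(1)])

lemma toeplitz_bergman: "g \<in> bergman_space \<Longrightarrow> toeplitz u g \<in> bergman_space"
  by (simp add: toeplitz_def bergman_proj_bergman bounded_symbol_mult_L2 u bergman_spaceD(1))

lemma L2_inner_toeplitz:
  "g \<in> bergman_space \<Longrightarrow> h \<in> bergman_space \<Longrightarrow> L2_inner (toeplitz u g) h = L2_inner (\<lambda>z. u z * g z) h"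
  by (simp add: toeplitz_def L2_inner_bergman_proj bounded_symbol_mult_L2 u bergman_spaceD(1))

lemma toeplitz_linear:
  assumes g: "g \<in> bergman_space" and h: "h \<in> bergman_space"
  shows "toeplitz u (\<lambda>z. a * g z + b * h z) = (\<lambda>z. a * toeplitz u g z + b * toeplitz u h z)"
proof (rule bergman_eqI)
  have lin: "(\<lambda>z. a * g z + b * h z) \<in> bergman_space"
    by (intro bergman_space_add bergman_space_cmult g h)
  then show "toeplitz u (\<lambda>z. a * g z + b * h z) \<in> bergman_space"
    by (rule toeplitz_bergman)
  show "(\<lambda>z. a * toeplitz u g z + b * toeplitz u h z) \<in> bergman_space"
    by (intro bergman_space_add bergman_space_cmult toeplitz_bergman g h)
  fix n
  have "L2_inner (\<lambda>z. u z * (a * g z + b * h z)) (disk_power n) =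
      L2_inner (\<lambda>z. a * (u z * g z) + b * (u z * h z)) (disk_power n)"
    by (rule L2_inner_cong) (auto simp: algebra_simps)
  also have "\<dots> = a * L2_inner (\<lambda>z. u z * g z) (disk_power n) + b * L2_inner (\<lambda>z. u z * h z) (disk_power n)"
    by (simp only: L2_inner_add_left[OF L2_disk_cmult[OF symbol_times_bergman_L2[OF g]]
          L2_disk_cmult[OF symbol_times_bergman_L2[OF h]] disk_power_L2]
        L2_inner_cmult_left)
  finally show "L2_inner (toeplitz u (\<lambda>z. a * g z + b * h z)) (disk_power n) =
      L2_inner (\<lambda>z. a * toeplitz u g z + b * toeplitz u h z) (disk_power n)"
    using g h lin
    by (subst L2_inner_add_left)
       (auto intro: L2_disk_cmult bergman_spaceD(1) toeplitz_bergman disk_power_L2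
         simp: L2_inner_cmult_left L2_inner_toeplitz disk_power_bergman)
qed

end

lemma toeplitz_adjoint:
  assumes u: "bounded_symbol u" and g: "g \<in> bergman_space" and h: "h \<in> bergman_space"
  shows "L2_inner (toeplitz u g) h = L2_inner g (toeplitz (\<lambda>z. cnj (u z)) h)"
proof -
  have "L2_inner (toeplitz u g) h = L2_inner g (\<lambda>z. cnj (u z) * h z)"
    using u g h by (simp add: L2_inner_toeplitz) (simp add: L2_inner_def mult_ac)
  also have "\<dots> = cnj (L2_inner (\<lambda>z. cnj (u z) * h z) g)"
    by (rule L2_inner_cnj[symmetric])
  also have "\<dots> = cnj (L2_inner (toeplitz (\<lambda>z. cnj (u z)) h) g)"
    using g h by (simp add: L2_inner_toeplitz bounded_symbol_cnj[OF u])
  finally show ?thesis by (simp add: L2_inner_cnj)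
qed

lemma bergman_adjoint_toeplitz_cnj:
  "bounded_symbol u \<Longrightarrow> bergman_adjoint (toeplitz u) (toeplitz (\<lambda>z. cnj (u z)))"
  by (simp add: bergman_adjoint_def toeplitz_bergman bounded_symbol_cnj toeplitz_adjoint)

lemma bergman_adjoint_unique:
  assumes "bergman_adjoint T S" "bergman_adjoint T S'" and h: "h \<in> bergman_space"
  shows "S h = S' h"
proof (rule bergman_eqI)
  show "S h \<in> bergman_space" "S' h \<in> bergman_space"
    using assms by (auto simp: bergman_adjoint_def)
  fix n
  have "L2_inner (disk_power n) (S h) = L2_inner (disk_power n) (S' h)"
    using assms disk_power_bergman by (metis bergman_adjoint_def)
  then have "cnj (L2_inner (disk_power n) (S h)) = cnj (L2_inner (disk_power n) (S' h))"
    by (rule arg_cong)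
  then show "L2_inner (S h) (disk_power n) = L2_inner (S' h) (disk_power n)"
    by (simp only: L2_inner_cnj)
qed

text \<open>
  This is the form ||Tg|| = ||T*g|| of normality, polarized. On the Bergman space the adjoint
  provided by normality is the operator of the conjugate symbol; elsewhere it is arbitrary.
\<close>
lemma toeplitz_normal_inner:
  assumes u: "bounded_symbol u" and normal: "bergman_normal (toeplitz u)"
    and g: "g \<in> bergman_space" and h: "h \<in> bergman_space"
  defines "S \<equiv> toeplitz (\<lambda>z. cnj (u z))"
  shows "L2_inner (toeplitz u g) (toeplitz u h) = L2_inner (S g) (S h)"
proof -
  obtain S' where S': "bergman_adjoint (toeplitz u) S'"
    and comm: "\<And>g. g \<in> bergman_space \<Longrightarrow> toeplitz u (S' g) = S' (toeplitz u g)"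
    using normal by (auto simp: bergman_normal_def)
  have S'_eq: "S' g = S g" if "g \<in> bergman_space" for g
    unfolding S_def using bergman_adjoint_unique[OF S' bergman_adjoint_toeplitz_cnj[OF u] that] .
  have adj: "L2_inner (toeplitz u x) y = L2_inner x (S y)" if "x \<in> bergman_space" "y \<in> bergman_space" for x y
    unfolding S_def by (rule toeplitz_adjoint[OF u that])
  have Sb: "S x \<in> bergman_space" if "x \<in> bergman_space" for x
    unfolding S_def by (rule toeplitz_bergman[OF bounded_symbol_cnj[OF u] that])
  have "L2_inner (toeplitz u g) (toeplitz u h) = L2_inner g (S (toeplitz u h))"
    by (rule adj[OF g toeplitz_bergman[OF u h]])
  also have "S (toeplitz u h) = toeplitz u (S h)"
    using comm[OF h] S'_eq[OF h] S'_eq[OF toeplitz_bergman[OF u h]] by simp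
  also have "L2_inner g (toeplitz u (S h)) = cnj (L2_inner (toeplitz u (S h)) g)"
    by (rule L2_inner_cnj[symmetric])
  also have "\<dots> = cnj (L2_inner (S h) (S g))"
    by (simp only: adj[OF Sb[OF h] g])
  finally show ?thesis by (simp only: L2_inner_cnj)
qed

text \<open>
  By linearity of the projection the adjoint is the operator \<kappa>T + \<mu>, which commutes with T.
\<close>
lemma toeplitz_normalI:
  assumes u: "bounded_symbol u" and affine: "\<And>z. z \<in> unit_disk \<Longrightarrow> cnj (u z) = \<kappa> * u z + \<mu>"
  shows "bergman_normal (toeplitz u)"
proof -
  let ?S = "toeplitz (\<lambda>z. cnj (u z))"
  have S_eq: "?S g = (\<lambda>z. \<kappa> * toeplitz u g z + \<mu> * g z)" if g: "g \<in> bergman_space" for g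
  proof (rule bergman_eqI)
    show "?S g \<in> bergman_space"
      by (rule toeplitz_bergman[OF bounded_symbol_cnj[OF u] g])
    show "(\<lambda>z. \<kappa> * toeplitz u g z + \<mu> * g z) \<in> bergman_space"
      by (intro bergman_space_add bergman_space_cmult toeplitz_bergman u g)
    fix n
    have "L2_inner (?S g) (disk_power n) = L2_inner (\<lambda>z. cnj (u z) * g z) (disk_power n)"
      by (rule L2_inner_toeplitz[OF bounded_symbol_cnj[OF u] g disk_power_bergman])
    also have "\<dots> = L2_inner (\<lambda>z. \<kappa> * (u z * g z) + \<mu> * g z) (disk_power n)"
      by (rule L2_inner_cong) (auto simp: affine algebra_simps)
    also have "\<dots> = \<kappa> * L2_inner (\<lambda>z. u z * g z) (disk_power n) + \<mu> * L2_inner g (disk_power n)"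
      by (simp only: L2_inner_add_left[OF L2_disk_cmult[OF symbol_times_bergman_L2[OF u g]]
          L2_disk_cmult[OF bergman_spaceD(1)[OF g]] disk_power_L2] L2_inner_cmult_left)
    also have "\<dots> = L2_inner (\<lambda>z. \<kappa> * toeplitz u g z + \<mu> * g z) (disk_power n)"
      using g by (subst L2_inner_add_left)
        (auto intro: L2_disk_cmult bergman_spaceD(1) toeplitz_bergman u disk_power_L2
          simp: L2_inner_cmult_left L2_inner_toeplitz[OF u] disk_power_bergman)
    finally show "L2_inner (?S g) (disk_power n) = L2_inner (\<lambda>z. \<kappa> * toeplitz u g z + \<mu> * g z) (disk_power n)" .
  qed
  have "toeplitz u (?S g) = ?S (toeplitz u g)" if g: "g \<in> bergman_space" for g
    using g by (simp only: S_eq toeplitz_bergman[OF u] toeplitz_linear[OF u])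
  then show ?thesis
    unfolding bergman_normal_def using bergman_adjoint_toeplitz_cnj[OF u] toeplitz_bergman[OF u] by blast
qed



section \<open>Sequences given by rational functions, and their poles\<close>

text \<open>
  The sequence f agrees for large n with a rational function of n that has no pole at -r. The denominator
  is multiplied out, so that its zeros among the integers need no attention. The sign is chosen since all
  poles that occur are negative integers.
\<close>
definition regular_at :: "int \<Rightarrow> (nat \<Rightarrow> complex) \<Rightarrow> bool" where
  "regular_at r f \<longleftrightarrow> (\<exists>A B. poly B (- of_int r) \<noteq> 0 \<and>
     (\<forall>\<^sub>F n in sequentially. f n * poly B (of_nat n) = poly A (of_nat n)))"

lemma regular_at_cong:
  assumes "regular_at r f" "\<forall>\<^sub>F n in sequentially. f n = g n"
  shows "regular_at r g"
proof -
  obtain A B where AB: "poly B (- of_int r) \<noteq> 0"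
    "\<forall>\<^sub>F n in sequentially. f n * poly B (of_nat n) = poly A (of_nat n)"
    using assms(1) by (auto simp: regular_at_def)
  from AB(2) assms(2) have "\<forall>\<^sub>F n in sequentially. g n * poly B (of_nat n) = poly A (of_nat n)"
    by eventually_elim simp
  with AB(1) show ?thesis by (auto simp: regular_at_def)
qed

lemma regular_at_const: "regular_at r (\<lambda>n. c)"
  unfolding regular_at_def by (intro exI[of _ "[:c:]"] exI[of _ "[:1:]"]) simp

lemma regular_at_shift: "regular_at r (\<lambda>n. of_nat n + of_int q)"
  unfolding regular_at_def by (intro exI[of _ "[:of_int q, 1:]"] exI[of _ "[:1:]"]) simp

lemma regular_at_add:
  assumes "regular_at r f" "regular_at r g"
  shows "regular_at r (\<lambda>n. f n + g n)"
proof -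
  obtain A B where AB: "poly B (- of_int r) \<noteq> 0"
    "\<forall>\<^sub>F n in sequentially. f n * poly B (of_nat n) = poly A (of_nat n)"
    using assms(1) by (auto simp: regular_at_def)
  obtain C D where CD: "poly D (- of_int r) \<noteq> 0"
    "\<forall>\<^sub>F n in sequentially. g n * poly D (of_nat n) = poly C (of_nat n)"
    using assms(2) by (auto simp: regular_at_def)
  from AB(2) CD(2) have "\<forall>\<^sub>F n in sequentially.
      (f n + g n) * poly (B * D) (of_nat n) = poly (A * D + C * B) (of_nat n)"
  proof eventually_elim
    case (elim n)
    have "(f n + g n) * poly (B * D) (of_nat n) =
        (f n * poly B (of_nat n)) * poly D (of_nat n) + (g n * poly D (of_nat n)) * poly B (of_nat n)"
      by (simp add: algebra_simps)
    then show ?case by (simp only: elim poly_add poly_mult)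
  qed
  with AB(1) CD(1) show ?thesis
    unfolding regular_at_def by (intro exI[of _ "A * D + C * B"] exI[of _ "B * D"]) simp
qed

lemma regular_at_mult:
  assumes "regular_at r f" "regular_at r g"
  shows "regular_at r (\<lambda>n. f n * g n)"
proof -
  obtain A B where AB: "poly B (- of_int r) \<noteq> 0"
    "\<forall>\<^sub>F n in sequentially. f n * poly B (of_nat n) = poly A (of_nat n)"
    using assms(1) by (auto simp: regular_at_def)
  obtain C D where CD: "poly D (- of_int r) \<noteq> 0"
    "\<forall>\<^sub>F n in sequentially. g n * poly D (of_nat n) = poly C (of_nat n)"
    using assms(2) by (auto simp: regular_at_def)
  from AB(2) CD(2) have "\<forall>\<^sub>F n in sequentially.
      (f n * g n) * poly (B * D) (of_nat n) = poly (A * C) (of_nat n)"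
  proof eventually_elim
    case (elim n)
    have "(f n * g n) * poly (B * D) (of_nat n) =
        (f n * poly B (of_nat n)) * (g n * poly D (of_nat n))"
      by (simp add: mult_ac)
    then show ?case by (simp only: elim poly_mult)
  qed
  with AB(1) CD(1) show ?thesis
    unfolding regular_at_def by (intro exI[of _ "A * C"] exI[of _ "B * D"]) simp
qed

lemma regular_at_diff:
  assumes "regular_at r f" "regular_at r g"
  shows "regular_at r (\<lambda>n. f n - g n)"
  using regular_at_add[OF assms(1) regular_at_mult[OF regular_at_const[of r "-1"] assms(2)]] by simp

lemma regular_at_sum:
  "(\<And>i. i \<in> I \<Longrightarrow> regular_at r (f i)) \<Longrightarrow> regular_at r (\<lambda>n. \<Sum>i\<in>I. f i n)"
  by (induction I rule: infinite_finite_induct) (auto intro: regular_at_add regular_at_const)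

lemma eventually_shift_nonzero: "\<forall>\<^sub>F n in sequentially. of_nat n + of_int q \<noteq> (0::complex)"
  using eventually_gt_at_top[of "nat \<bar>q\<bar>"]
proof eventually_elim
  case (elim n)
  then have "int n + q \<noteq> 0" by linarith
  then show ?case by (metis of_int_add of_int_eq_0_iff of_int_of_nat_eq)
qed

lemma regular_at_divide_shift:
  assumes "q \<noteq> r"
  shows "regular_at r (\<lambda>n. c / (of_nat n + of_int q))"
  unfolding regular_at_def
proof (intro exI conjI)
  show "poly [:of_int q, 1:] (- of_int r) \<noteq> (0::complex)"
    using assms by simp
  show "\<forall>\<^sub>F n in sequentially. c / (of_nat n + of_int q) * poly [:of_int q, 1:] (of_nat n) = poly [:c:] (of_nat n)"
    using eventually_shift_nonzero[of q]
    by eventually_elim (simp add: add.commute)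
qed

lemma regular_at_clear_pole: "regular_at r (\<lambda>n. (of_nat n + of_int r) * (c / (of_nat n + of_int q)))"
proof (cases "q = r")
  case True
  show ?thesis
    by (rule regular_at_cong[OF regular_at_const[of r c]])
       (use eventually_shift_nonzero[of q] in eventually_elim, use True in simp)
next
  case False
  then show ?thesis by (intro regular_at_mult regular_at_shift regular_at_divide_shift)
qed

text \<open>
  If the rational function behind f is A / B, then c B(n) + (n + r) A(n) is a polynomial with infinitely
  many zeros, hence zero, and its value at -r is c B(-r). So an identity of rational functions can be
  tested at a single pole: c collects the leading coefficient there, and the other terms only have to be
  regular.
\<close>
lemma residue_zero:
  assumes f: "regular_at r f" and eq: "\<forall>\<^sub>F n in sequentially. c + (of_nat n + of_int r) * f n = 0"
  shows "c = 0"
proof -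
  obtain A B where B: "poly B (- of_int r) \<noteq> 0"
    and AB: "\<forall>\<^sub>F n in sequentially. f n * poly B (of_nat n) = poly A (of_nat n)"
    using f by (auto simp: regular_at_def)
  define p where "p = smult c B + [:of_int r, 1:] * A"
  have "\<forall>\<^sub>F n in sequentially. poly p (of_nat n) = 0"
    using AB eq
  proof eventually_elim
    case (elim n)
    have "poly p (of_nat n) = c * poly B (of_nat n) + (of_nat n + of_int r) * (f n * poly B (of_nat n))"
      unfolding elim(1) by (simp add: p_def algebra_simps)
    also have "\<dots> = (c + (of_nat n + of_int r) * f n) * poly B (of_nat n)"
      by (simp add: algebra_simps)
    finally show ?case using elim(2) by simp
  qed
  then obtain N where N: "\<And>n. n \<ge> N \<Longrightarrow> poly p (of_nat n) = 0"
    by (auto simp: eventually_sequentially)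
  have "infinite ((of_nat :: nat \<Rightarrow> complex) ` {N..})"
    by (simp add: finite_image_iff inj_on_def infinite_Ici)
  moreover have "(of_nat :: nat \<Rightarrow> complex) ` {N..} \<subseteq> {x. poly p x = 0}"
    using N by auto
  ultimately have "p = 0"
    using poly_roots_finite[of p] finite_subset by blast
  then have "poly p (- of_int r) = 0" by simp
  then show ?thesis using B by (simp add: p_def)
qed

section \<open>The commutator of two matrices of moments\<close>

text \<open>
  A matrix entry of the symbol (a + b |z|^2) z^k is a / (M + 1) + b / (M + 2), where M is the larger of
  the row and column indices. Here M = n + x, and x stays fixed while n varies along a diagonal.
\<close>
definition weight :: "complex \<Rightarrow> complex \<Rightarrow> int \<Rightarrow> nat \<Rightarrow> complex" where
  "weight a b x n = a / (of_nat n + of_int (x + 1)) + b / (of_nat n + of_int (x + 2))"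

lemma regular_at_weight: "r \<noteq> x + 1 \<Longrightarrow> r \<noteq> x + 2 \<Longrightarrow> regular_at r (weight a b x)"
  unfolding weight_def[abs_def] by (intro regular_at_add regular_at_divide_shift) auto

lemma regular_at_clear_weight: "regular_at r (\<lambda>n. (of_nat n + of_int r) * weight a b x n)"
  unfolding weight_def distrib_left by (intro regular_at_add regular_at_clear_pole)

text \<open>
  The number \<langle>u z^n, z^m\<rangle> for the symbol u whose component of angular degree k is
  (P(k) + Q(k) |z|^2) z^k, with cnj(z)^(-k) in place of z^k when k < 0.
\<close>
definition moment_entry :: "(int \<Rightarrow> complex) \<Rightarrow> (int \<Rightarrow> complex) \<Rightarrow> nat \<Rightarrow> nat \<Rightarrow> complex" where
  "moment_entry P Q n m = weight (P (int m - int n)) (Q (int m - int n)) 0 (max n m)"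

text \<open>
  Entrywise commutation of the two operators: the factor j + 1 is the reciprocal of the squared norm of
  z^j, which enters when the product of two operators is expanded over the monomials. For matrices of
  bandwidth K the terms with j > m + K vanish.
\<close>
definition entries_commute ::
  "nat \<Rightarrow> (int \<Rightarrow> complex) \<Rightarrow> (int \<Rightarrow> complex) \<Rightarrow> (int \<Rightarrow> complex) \<Rightarrow> (int \<Rightarrow> complex) \<Rightarrow> bool" where
  "entries_commute K P Q R S \<longleftrightarrow> (\<forall>n m. (\<Sum>j\<le>m + K. (of_nat j + 1) *
     (moment_entry R S n j * moment_entry P Q j m - moment_entry P Q n j * moment_entry R S j m)) = 0)"

definition band_limited :: "nat \<Rightarrow> (int \<Rightarrow> complex) \<Rightarrow> bool" where
  "band_limited K P \<longleftrightarrow> (\<forall>k. \<bar>k\<bar> > int K \<longrightarrow> P k = 0)"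

text \<open>
  This is the condition on Fourier coefficients that makes the symbol real-valued.
\<close>
definition hermitian :: "(int \<Rightarrow> complex) \<Rightarrow> bool" where
  "hermitian P \<longleftrightarrow> (\<forall>k. P (- k) = cnj (P k))"

lemma entries_commute_sym: "entries_commute K P Q R S \<Longrightarrow> entries_commute K R S P Q"
  unfolding entries_commute_def
proof (intro allI)
  fix n m
  assume "\<forall>n m. (\<Sum>j\<le>m + K. (of_nat j + 1) *
     (moment_entry R S n j * moment_entry P Q j m - moment_entry P Q n j * moment_entry R S j m)) = 0"
  then have "- (\<Sum>j\<le>m + K. (of_nat j + 1) *
     (moment_entry R S n j * moment_entry P Q j m - moment_entry P Q n j * moment_entry R S j m)) = 0"
    by simp
  then show "(\<Sum>j\<le>m + K. (of_nat j + 1) *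
     (moment_entry P Q n j * moment_entry R S j m - moment_entry R S n j * moment_entry P Q j m)) = 0"
    unfolding sum_negf[symmetric] by (simp add: algebra_simps)
qed

lemma moment_entry_diff:
  "moment_entry (\<lambda>k. R k - t * P k) (\<lambda>k. S k - t * Q k) n m = moment_entry R S n m - t * moment_entry P Q n m"
  by (simp add: moment_entry_def weight_def diff_divide_distrib algebra_simps)

lemma entries_commute_diff:
  assumes "entries_commute K P Q R S"
  shows "entries_commute K P Q (\<lambda>k. R k - t * P k) (\<lambda>k. S k - t * Q k)"
  using assms unfolding entries_commute_def moment_entry_diff by (simp add: algebra_simps)

text \<open>
  Substituting j = n + i makes the index set independent of n, so that on the diagonal m = n + d every
  summand is a rational function of n. Only n \<ge> K is considered, where no index n + i is negative.
\<close>
lemma entries_commute_diagonal: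
  assumes comm: "entries_commute K P Q R S"
    and P: "band_limited K P" and Q: "band_limited K Q" and R: "band_limited K R" and S: "band_limited K S"
  shows "\<forall>\<^sub>F n in sequentially. (\<Sum>i\<in>{-int K..int K}. (of_nat n + of_int (i + 1)) *
    (weight (R i) (S i) (max 0 i) n * weight (P (int d - i)) (Q (int d - i)) (max i (int d)) n
     - weight (P i) (Q i) (max 0 i) n * weight (R (int d - i)) (S (int d - i)) (max i (int d)) n)) = 0"
  using eventually_ge_at_top[of K]
proof eventually_elim
  case (elim n)
  define F where "F = (\<lambda>j. (of_nat j + 1) *
     (moment_entry R S n j * moment_entry P Q j (n + d) - moment_entry P Q n j * moment_entry R S j (n + d)))"
  have "0 = (\<Sum>j\<le>n + d + K. F j)"
    using comm by (simp add: entries_commute_def F_def)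
  also have "\<dots> = (\<Sum>j\<in>{n - K..n + K}. F j)"
  proof (rule sum.mono_neutral_right)
    show "\<forall>j\<in>{..n + d + K} - {n - K..n + K}. F j = 0"
    proof
      fix j assume "j \<in> {..n + d + K} - {n - K..n + K}"
      then have "\<bar>int j - int n\<bar> > int K" using elim by auto
      then have "moment_entry R S n j = 0" "moment_entry P Q n j = 0"
        using P Q R S by (simp_all add: moment_entry_def weight_def band_limited_def)
      then show "F j = 0" by (simp add: F_def)
    qed
  qed auto
  also have "\<dots> = (\<Sum>i\<in>{-int K..int K}. F (nat (int n + i)))"
    by (rule sum.reindex_bij_witness[of _ "\<lambda>i. nat (int n + i)" "\<lambda>j. int j - int n"]) (use elim in auto)
  also have "\<dots> = (\<Sum>i\<in>{-int K..int K}. (of_nat n + of_int (i + 1)) *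
    (weight (R i) (S i) (max 0 i) n * weight (P (int d - i)) (Q (int d - i)) (max i (int d)) n
     - weight (P i) (Q i) (max 0 i) n * weight (R (int d - i)) (S (int d - i)) (max i (int d)) n))"
  proof (rule sum.cong[OF refl])
    fix i assume i: "i \<in> {-int K..int K}"
    define j where "j = nat (int n + i)"
    have j: "int j = int n + i" using i elim by (simp add: j_def)
    have jc: "of_nat j = (of_nat n + of_int i :: complex)"
      using arg_cong[OF j, where f = "of_int :: int \<Rightarrow> complex"] by simp
    have shift: "weight a b 0 k = weight a b x n" if "int k = int n + x" for a b k x
    proof -
      have "of_nat k = (of_nat n + of_int x :: complex)"
        using arg_cong[OF that, where f = "of_int :: int \<Rightarrow> complex"] by simp
      then show ?thesis by (simp add: weight_def add.assoc)
    qed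
    have 1: "moment_entry A B n j = weight (A i) (B i) (max 0 i) n" for A B
      using j unfolding moment_entry_def by (subst shift[where x = "max 0 i"]) auto
    have 2: "moment_entry A B j (n + d) = weight (A (int d - i)) (B (int d - i)) (max i (int d)) n" for A B
      using j unfolding moment_entry_def by (subst shift[where x = "max i (int d)"]) (auto simp: algebra_simps)
    show "F (nat (int n + i)) = (of_nat n + of_int (i + 1)) *
      (weight (R i) (S i) (max 0 i) n * weight (P (int d - i)) (Q (int d - i)) (max i (int d)) n
       - weight (P i) (Q i) (max 0 i) n * weight (R (int d - i)) (S (int d - i)) (max i (int d)) n)"
      unfolding F_def j_def[symmetric] 1 2 jc by (simp add: add.assoc)
  qed
  finally show ?case by simp
qed

text \<open>
  For i \<ge> d the i-th summand has both weights at the same denominators n + i + 1 and n + i + 2. The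
  factor n + i + 1 leaves a simple pole at the former, while the latter is a double pole whose
  coefficient involves only Q and S. All other summands have at most a simple pole at n = -m - 2: the
  summand i = m + 1 because of its factor n + m + 2, the remaining ones because their first weight is
  regular there; this uses m \<ge> 1.
\<close>
lemma double_pole_relation:
  assumes comm: "entries_commute K P Q R S"
    and P: "band_limited K P" and Q: "band_limited K Q" and R: "band_limited K R" and S: "band_limited K S"
    and m: "1 \<le> m" "int d \<le> m"
  shows "S m * Q (int d - m) = Q m * S (int d - m)"
proof (cases "m \<le> int K")
  case False
  then show ?thesis using m Q S by (simp add: band_limited_def)
next
  case True
  let ?I = "{-int K..int K}"
  let ?m' = "int d - m"
  define y where "y = (\<lambda>n. of_nat n + of_int (m + 2) :: complex)"
  define summand where "summand = (\<lambda>i n. (of_nat n + of_int (i + 1)) *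
    (weight (R i) (S i) (max 0 i) n * weight (P (int d - i)) (Q (int d - i)) (max i (int d)) n
     - weight (P i) (Q i) (max 0 i) n * weight (R (int d - i)) (S (int d - i)) (max i (int d)) n))"
  define c where "c = S m * Q ?m' - Q m * S ?m'"
  \<comment> \<open>The summand i = m times the square of y is -c + y g, by expansion in powers of y.\<close>
  define g where "g = (\<lambda>n. c + (R m * Q ?m' + S m * P ?m' - P m * S ?m' - Q m * R ?m') +
    y n * ((R m * P ?m' - P m * R ?m') / (of_nat n + of_int (m + 1))))"
  have y_reg: "regular_at (m + 2) y"
    unfolding y_def by (rule regular_at_shift)
  have g_reg: "regular_at (m + 2) g"
    unfolding g_def by (intro regular_at_add regular_at_const regular_at_mult y_reg regular_at_divide_shift) simp
  have prod_reg: "regular_at (m + 2) (\<lambda>n. y n * ((of_nat n + of_int (i + 1)) * (weight a b (max 0 i) n * weight a' b' x n)))"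
    if i: "i \<noteq> m" and x: "x = max i (int d)" for a b a' b' i x
  proof (cases "i = m + 1")
    case True
    have "regular_at (m + 2) (\<lambda>n. (y n * weight a b (max 0 i) n) * (y n * weight a' b' x n))"
      unfolding y_def by (intro regular_at_mult regular_at_clear_weight)
    then show ?thesis
      by (rule regular_at_cong) (simp add: y_def True mult_ac)
  next
    case False
    then have "regular_at (m + 2) (weight a b (max 0 i))"
      using i m by (intro regular_at_weight) auto
    then have "regular_at (m + 2) (\<lambda>n. (of_nat n + of_int (i + 1)) * (weight a b (max 0 i) n * (y n * weight a' b' x n)))"
      unfolding y_def by (intro regular_at_mult regular_at_clear_weight regular_at_shift)
    then show ?thesis
      by (rule regular_at_cong) (simp add: mult_ac)
  qed
  have summand_reg: "regular_at (m + 2) (\<lambda>n. y n * summand i n)" if "i \<noteq> m" for i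
    unfolding summand_def right_diff_distrib
    by (intro regular_at_diff prod_reg that refl)
  have summand_m: "\<forall>\<^sub>F n in sequentially. y n * y n * summand m n = - c + y n * g n"
    using eventually_shift_nonzero[of "m + 1"] eventually_shift_nonzero[of "m + 2"]
  proof eventually_elim
    case (elim n)
    define w where "w = (of_nat n + of_int (m + 1) :: complex)"
    have yw: "y n = w + 1" by (simp add: y_def w_def)
    have nz: "w \<noteq> 0" "w + 1 \<noteq> 0"
      using elim unfolding yw[symmetric] by (simp_all only: w_def y_def not_False_eq_True)
    have mx: "max 0 m = m" "max m (int d) = m" using m by auto
    have wt: "weight a b m n = a / w + b / (w + 1)" for a b
      using yw by (simp add: weight_def w_def y_def)
    have prod: "(w + 1) * (w + 1) * (w * ((a / w + b / (w + 1)) * (a' / w + b' / (w + 1)))) =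
        - (b * b') + (w + 1) * (b * b' + (a * b' + b * a') + (w + 1) * (a * a' / w))" for a b a' b'
    proof -
      have alg: "v * v * (w * ((a * s + b * t) * (a' * s + b' * t))) =
          - (b * b') + v * (b * b' + (a * b' + b * a') + v * (a * a' * s))"
        if "w * s = 1" "v * t = 1" "v = w + 1" for s t v
        using that by algebra
      show ?thesis
        using alg[of "1 / w" "w + 1" "1 / (w + 1)"] nz by simp
    qed
    have "y n * y n * summand m n =
        (w + 1) * (w + 1) * (w * ((R m / w + S m / (w + 1)) * (P ?m' / w + Q ?m' / (w + 1)))) -
        (w + 1) * (w + 1) * (w * ((P m / w + Q m / (w + 1)) * (R ?m' / w + S ?m' / (w + 1))))"
      unfolding summand_def mx wt yw w_def[symmetric] by (simp add: algebra_simps)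
    also have "\<dots> = - c + y n * g n"
      unfolding prod g_def yw w_def[symmetric] c_def by (simp add: algebra_simps diff_divide_distrib)
    finally show ?case .
  qed
  have "\<forall>\<^sub>F n in sequentially. - c + y n * ((\<Sum>i\<in>?I - {m}. y n * summand i n) + g n) = 0"
    using summand_m entries_commute_diagonal[OF comm P Q R S, of d]
  proof eventually_elim
    case (elim n)
    have "0 = y n * y n * (\<Sum>i\<in>?I. summand i n)"
      using elim(2) by (simp add: summand_def)
    also have "(\<Sum>i\<in>?I. summand i n) = summand m n + (\<Sum>i\<in>?I - {m}. summand i n)"
      using True m by (intro sum.remove) auto
    also have "y n * y n * \<dots> = y n * y n * summand m n + y n * (\<Sum>i\<in>?I - {m}. y n * summand i n)"
      by (simp add: distrib_left sum_distrib_left mult.assoc)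
    finally show ?case unfolding elim(1) by (simp add: algebra_simps)
  qed
  moreover have "regular_at (m + 2) (\<lambda>n. (\<Sum>i\<in>?I - {m}. y n * summand i n) + g n)"
    by (intro regular_at_add regular_at_sum g_reg summand_reg) auto
  ultimately have "- c = 0"
    unfolding y_def by (intro residue_zero[of "m + 2"])
  then show ?thesis by (simp add: c_def)
qed


text \<open>
  The scalar factor that multiplies E(i) P(d - i) - P(i) E(d - i) in the commutator of two harmonic
  symbols, after multiplication by n + d + 1. It equals (n + i + 1) / (n + 1) for i < 0, is constant for
  0 \<le> i \<le> d, and equals (n + d + 1) / (n + i + 1) for i > d.
\<close>
lemma weight_quotient_regular:
  fixes d :: nat and i r :: int
  assumes "r \<noteq> 1" "int d < i \<Longrightarrow> r \<noteq> i + 1"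
  defines "\<phi> \<equiv> \<lambda>n. (of_nat n + of_int (i + 1)) * (of_nat n + of_int (int d + 1)) /
    ((of_nat n + of_int (max 0 i + 1)) * (of_nat n + of_int (max i (int d) + 1))) :: complex"
  shows "regular_at r \<phi>"
proof -
  consider "i < 0" | "0 \<le> i" "i \<le> int d" | "int d < i" by linarith
  then show ?thesis
  proof cases
    case 1
    have "regular_at r (\<lambda>n. (of_nat n + of_int (i + 1)) * (1 / (of_nat n + of_int 1)))"
      using assms by (intro regular_at_mult regular_at_shift regular_at_divide_shift) auto
    then show ?thesis
      by (rule regular_at_cong)
         (use eventually_shift_nonzero[of "int d + 1"] in eventually_elim, use 1 in \<open>simp add: \<phi>_def\<close>)
  next
    case 2
    show ?thesis
      by (rule regular_at_cong[OF regular_at_const[of r 1]])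
         (use eventually_shift_nonzero[of "int d + 1"] eventually_shift_nonzero[of "i + 1"] in eventually_elim,
          use 2 in \<open>simp add: \<phi>_def max_def\<close>)
  next
    case 3
    have "regular_at r (\<lambda>n. (of_nat n + of_int (int d + 1)) * (1 / (of_nat n + of_int (i + 1))))"
      using assms 3 by (intro regular_at_mult regular_at_shift regular_at_divide_shift) auto
    then show ?thesis
      by (rule regular_at_cong)
         (use eventually_shift_nonzero[of "i + 1"] in eventually_elim, use 3 in \<open>simp add: \<phi>_def\<close>)
  qed
qed

text \<open>
  For two harmonic symbols only the summand i = m has a pole at n = -m - 1, once the factor n + d + 1 has
  cleared the common denominator.
\<close>
lemma harmonic_relation:
  assumes comm: "entries_commute K P (\<lambda>_. 0) E (\<lambda>_. 0)"
    and P: "band_limited K P" and E: "band_limited K E"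
    and m: "int d < m"
  shows "E m * P (int d - m) = P m * E (int d - m)"
proof (cases "m \<le> int K")
  case False
  then show ?thesis using m P E by (simp add: band_limited_def)
next
  case True
  let ?I = "{-int K..int K}"
  define C where "C = (\<lambda>i. E i * P (int d - i) - P i * E (int d - i))"
  define \<phi> where "\<phi> = (\<lambda>i n. (of_nat n + of_int (i + 1)) * (of_nat n + of_int (int d + 1)) /
    ((of_nat n + of_int (max 0 i + 1)) * (of_nat n + of_int (max i (int d) + 1))) :: complex)"
  define y where "y = (\<lambda>n. of_nat n + of_int (m + 1) :: complex)"
  have zero: "band_limited K (\<lambda>_. 0)" by (simp add: band_limited_def)
  have \<phi>_reg: "regular_at (m + 1) (\<phi> i)" if "i \<noteq> m" for i
    unfolding \<phi>_def using that m by (intro weight_quotient_regular) auto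
  have "\<forall>\<^sub>F n in sequentially.
      of_int (int d - m) * C m + y n * (C m + (\<Sum>i\<in>?I - {m}. C i * \<phi> i n)) = 0"
    using entries_commute_diagonal[OF comm P zero E zero, of d] eventually_shift_nonzero[of "m + 1"]
  proof eventually_elim
    case (elim n)
    have y0: "y n \<noteq> 0" using elim(2) by (simp only: y_def not_False_eq_True)
    have cancel: "y n * (a * (b / y n)) = a * b" for a b using y0 by simp
    have "0 = (of_nat n + of_int (int d + 1)) * (\<Sum>i\<in>?I. (of_nat n + of_int (i + 1)) *
      (weight (E i) 0 (max 0 i) n * weight (P (int d - i)) 0 (max i (int d)) n
       - weight (P i) 0 (max 0 i) n * weight (E (int d - i)) 0 (max i (int d)) n))"
      using elim(1) by simp
    also have "\<dots> = (\<Sum>i\<in>?I. C i * \<phi> i n)"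
      unfolding sum_distrib_left
      by (intro sum.cong) (simp_all add: weight_def C_def \<phi>_def diff_divide_distrib algebra_simps)
    also have "\<dots> = C m * \<phi> m n + (\<Sum>i\<in>?I - {m}. C i * \<phi> i n)"
      using True m by (intro sum.remove) auto
    also have "\<phi> m n = (of_nat n + of_int (int d + 1)) / y n"
      using m elim(2) by (simp add: \<phi>_def y_def)
    finally have "0 = C m * ((of_nat n + of_int (int d + 1)) / y n) + (\<Sum>i\<in>?I - {m}. C i * \<phi> i n)" .
    then have "0 = y n * (C m * ((of_nat n + of_int (int d + 1)) / y n) + (\<Sum>i\<in>?I - {m}. C i * \<phi> i n))"
      by (simp only: mult_zero_right)
    also have "\<dots> = C m * (of_nat n + of_int (int d + 1)) + y n * (\<Sum>i\<in>?I - {m}. C i * \<phi> i n)"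
      by (simp only: distrib_left cancel)
    also have "of_nat n + of_int (int d + 1) = of_int (int d - m) + y n"
      by (simp add: y_def)
    finally show ?case by (simp add: algebra_simps)
  qed
  moreover have "regular_at (m + 1) (\<lambda>n. C m + (\<Sum>i\<in>?I - {m}. C i * \<phi> i n))"
    by (intro regular_at_add regular_at_const regular_at_sum regular_at_mult \<phi>_reg) auto
  ultimately have "of_int (int d - m) * C m = 0"
    unfolding y_def by (intro residue_zero[of "m + 1"])
  moreover have "of_int (int d - m) \<noteq> (0::complex)"
    using m by (simp only: of_int_eq_0_iff)
  ultimately have "C m = 0" by (metis mult_eq_0_iff)
  then show ?thesis by (simp add: C_def)
qed

text \<open>
  On the diagonal d = e + q, products of coefficients of E with coefficients of Q occur only for the top
  indices: E(e) Q(q) at i = e, and Q(q) E(e) at i = q. After multiplication by n + d + 1 the latter has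
  the pole n = -q - 2. The former then has its pole at n = -d - 2, which differs since e \<ge> 1, and the
  products of E with P are regular at -q - 2.
\<close>
lemma harmonic_commute_top_product:
  assumes comm: "entries_commute K P Q E (\<lambda>_. 0)"
    and P: "band_limited K P" and Q: "band_limited K Q" and E: "band_limited K E"
    and e: "1 \<le> e" "\<And>i. int e < i \<Longrightarrow> E i = 0"
    and q: "\<And>i. int q < i \<Longrightarrow> Q i = 0"
  shows "E (int e) * Q (int q) = 0"
proof (cases "e \<le> K \<and> q \<le> K")
  case False
  then show ?thesis using E Q by (auto simp: band_limited_def)
next
  case True
  let ?I = "{-int K..int K}"
  define d where "d = e + q"
  define r where "r = int q + 2"
  define c where "c = E (int e) * Q (int q)"
  define C where "C = (\<lambda>i. E i * P (int d - i) - P i * E (int d - i))"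
  define \<phi> where "\<phi> = (\<lambda>i n. (of_nat n + of_int (i + 1)) * (of_nat n + of_int (int d + 1)) /
    ((of_nat n + of_int (max 0 i + 1)) * (of_nat n + of_int (max i (int d) + 1))) :: complex)"
  \<comment> \<open>The local parameter at the pole, and the factor that clears the denominators of the harmonic part.\<close>
  define y where "y = (\<lambda>n. of_nat n + of_int r :: complex)"
  define z where "z = (\<lambda>n. of_nat n + of_int (int d + 1) :: complex)"
  have zero: "band_limited K (\<lambda>_. 0)" by (simp add: band_limited_def)
  have \<phi>_reg: "regular_at r (\<phi> i)" for i
    unfolding \<phi>_def r_def d_def using e(1) by (intro weight_quotient_regular) auto
  have "\<forall>\<^sub>F n in sequentially.
      c + y n * ((\<Sum>i\<in>?I. C i * \<phi> i n) + z n * (c / (of_nat n + of_int (int d + 2))) - c) = 0"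
    using entries_commute_diagonal[OF comm P Q E zero, of d] eventually_shift_nonzero[of r]
      eventually_shift_nonzero[of "int d + 1"] eventually_shift_nonzero[of "int e + 1"]
  proof eventually_elim
    case (elim n)
    have y0: "y n \<noteq> 0" using elim(2) by (simp only: y_def not_False_eq_True)
    have cancel: "y n * (a * (b / y n)) = a * b" for a b using y0 by simp
    define A where "A = (\<lambda>i. z n * ((of_nat n + of_int (i + 1)) / ((of_nat n + of_int (max 0 i + 1)) * (of_nat n + of_int (max i (int d) + 2)))))"
    define B where "B = (\<lambda>i. z n * ((of_nat n + of_int (i + 1)) / ((of_nat n + of_int (max 0 i + 2)) * (of_nat n + of_int (max i (int d) + 1)))))"
    have "0 = z n * (\<Sum>i\<in>?I. (of_nat n + of_int (i + 1)) *
      (weight (E i) 0 (max 0 i) n * weight (P (int d - i)) (Q (int d - i)) (max i (int d)) n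
       - weight (P i) (Q i) (max 0 i) n * weight (E (int d - i)) 0 (max i (int d)) n))"
      using elim(1) by simp
    also have "\<dots> = (\<Sum>i\<in>?I. C i * \<phi> i n + E i * Q (int d - i) * A i - Q i * E (int d - i) * B i)"
      unfolding sum_distrib_left
    proof (rule sum.cong[OF refl])
      fix i
      have split: "w * (x * (a / s * (p / t + b / t') - (p' / s + b' / s') * (a' / t))) =
          (a * p - p' * a') * (x * w / (s * t)) + a * b * (w * (x / (s * t'))) - b' * a' * (w * (x / (s' * t)))"
        for w x a s p t b t' p' b' s' a' :: complex
        by (simp add: diff_divide_distrib algebra_simps)
      show "z n * ((of_nat n + of_int (i + 1)) *
         (weight (E i) 0 (max 0 i) n * weight (P (int d - i)) (Q (int d - i)) (max i (int d)) n
          - weight (P i) (Q i) (max 0 i) n * weight (E (int d - i)) 0 (max i (int d)) n)) =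
         C i * \<phi> i n + E i * Q (int d - i) * A i - Q i * E (int d - i) * B i"
        unfolding weight_def C_def \<phi>_def A_def B_def z_def div_0 add_0_right by (rule split)
    qed
    also have "\<dots> = (\<Sum>i\<in>?I. C i * \<phi> i n) + (\<Sum>i\<in>?I. E i * Q (int d - i) * A i) - (\<Sum>i\<in>?I. Q i * E (int d - i) * B i)"
      by (simp add: sum.distrib sum_subtractf)
    also have "(\<Sum>i\<in>?I. E i * Q (int d - i) * A i) = (\<Sum>i\<in>{int e}. E i * Q (int d - i) * A i)"
    proof (rule sum.mono_neutral_right)
      show "\<forall>i\<in>?I - {int e}. E i * Q (int d - i) * A i = 0"
      proof
        fix i assume "i \<in> ?I - {int e}"
        then have "int e < i \<or> int q < int d - i" by (auto simp: d_def)
        then show "E i * Q (int d - i) * A i = 0" using e(2) q by auto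
      qed
    qed (use True in auto)
    also have "\<dots> = c * A (int e)" by (simp add: c_def d_def)
    also have "A (int e) = z n / (of_nat n + of_int (int d + 2))"
      using elim(4) by (simp add: A_def d_def)
    also have "(\<Sum>i\<in>?I. Q i * E (int d - i) * B i) = (\<Sum>i\<in>{int q}. Q i * E (int d - i) * B i)"
    proof (rule sum.mono_neutral_right)
      show "\<forall>i\<in>?I - {int q}. Q i * E (int d - i) * B i = 0"
      proof
        fix i assume "i \<in> ?I - {int q}"
        then have "int q < i \<or> int e < int d - i" by (auto simp: d_def)
        then show "Q i * E (int d - i) * B i = 0" using e(2) q by auto
      qed
    qed (use True in auto)
    also have "\<dots> = c * B (int q)" by (simp add: c_def d_def)
    also have "B (int q) = (y n - 1) / y n"
      using elim(3) by (simp add: B_def d_def z_def y_def r_def max_def)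
    finally have "0 = (\<Sum>i\<in>?I. C i * \<phi> i n) + c * (z n / (of_nat n + of_int (int d + 2))) - c * ((y n - 1) / y n)" .
    then have "0 = y n * ((\<Sum>i\<in>?I. C i * \<phi> i n) + c * (z n / (of_nat n + of_int (int d + 2))) - c * ((y n - 1) / y n))"
      by (simp only: mult_zero_right)
    also have "\<dots> = y n * ((\<Sum>i\<in>?I. C i * \<phi> i n) + c * (z n / (of_nat n + of_int (int d + 2)))) - c * (y n - 1)"
      by (simp only: right_diff_distrib[of "y n"] cancel)
    finally show ?case by (simp add: algebra_simps)
  qed
  moreover have "regular_at r (\<lambda>n. (\<Sum>i\<in>?I. C i * \<phi> i n) + z n * (c / (of_nat n + of_int (int d + 2))) - c)"
    unfolding z_def using e(1)
    by (intro regular_at_diff regular_at_add regular_at_const regular_at_sum regular_at_mult \<phi>_reg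
        regular_at_shift regular_at_divide_shift) (simp add: r_def d_def)
  ultimately have "c = 0"
    unfolding y_def by (intro residue_zero[of r])
  then show ?thesis by (simp add: c_def)
qed

text \<open>
  The hypothesis for i = l says that the quotient of x and w at l is real; for the other indices it then
  says that the quotient is the same.
\<close>
lemma real_proportional:
  fixes x w :: "'i \<Rightarrow> complex"
  assumes eq: "\<And>i l. i \<in> A \<Longrightarrow> l \<in> A \<Longrightarrow> x i * cnj (w l) = w i * cnj (x l)"
    and l: "l \<in> A" "w l \<noteq> 0"
  obtains t :: real where "\<And>i. i \<in> A \<Longrightarrow> x i = of_real t * w i"
proof -
  define s where "s = x l / w l"
  have "cnj s = s"
    using eq[OF l(1) l(1)] l(2) by (simp add: s_def field_simps)
  then obtain t where t: "s = of_real t"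
    by (metis Reals_cnj_iff Reals_cases)
  have "x i = of_real t * w i" if "i \<in> A" for i
  proof -
    have "cnj (x l) = cnj s * cnj (w l)" using l(2) by (simp add: s_def)
    then have "x i * cnj (w l) = s * w i * cnj (w l)"
      using eq[OF that l(1)] \<open>cnj s = s\<close> by (simp add: mult_ac)
    then show ?thesis using l(2) t by simp
  qed
  then show thesis by (rule that)
qed

lemma hermitian_eqI:
  assumes "hermitian x" "hermitian w" and "x k = of_real t * w k"
  shows "x (- k) = of_real t * w (- k)"
  using assms by (simp add: hermitian_def)

text \<open>
  The case in which the second symbol, with coefficients E, is harmonic. If it is constant, the
  combination (0, 1) works; otherwise the top coefficients force Q = 0, and then P is a real multiple of E.
\<close>
lemma harmonic_commute_dependent:
  assumes comm: "entries_commute K P Q E (\<lambda>_. 0)"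
    and P: "band_limited K P" "hermitian P" and Q: "band_limited K Q" "hermitian Q"
    and E: "band_limited K E" "hermitian E"
  obtains \<alpha> \<beta> :: real where "(\<alpha>, \<beta>) \<noteq> (0, 0)"
    "\<And>k. of_real \<alpha> * Q k = 0" "\<And>k. k \<noteq> 0 \<Longrightarrow> of_real \<alpha> * P k + of_real \<beta> * E k = 0"
proof (cases "\<forall>k. k \<noteq> 0 \<longrightarrow> E k = 0")
  case True
  show thesis by (rule that[of 0 1]) (use True in simp_all)
next
  case False
  have neg: "x (- k) \<noteq> 0" if "hermitian x" "x k \<noteq> 0" for x k
    using that by (simp add: hermitian_def)
  have degree: "\<exists>n\<ge>a. x (int n) \<noteq> 0 \<and> (\<forall>i. int n < i \<longrightarrow> x i = 0)"
    if x: "band_limited K x" "hermitian x" and k: "x k \<noteq> 0" "int a \<le> \<bar>k\<bar>" for x k a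
  proof -
    define Z where "Z = {n. x (int n) \<noteq> 0}"
    have "n \<le> K" if "n \<in> Z" for n
      using that x(1) unfolding Z_def band_limited_def by (cases "K < n") auto
    then have fin: "finite Z"
      by (auto intro: finite_subset[of _ "{..K}"])
    have "x \<bar>k\<bar> \<noteq> 0" using k(1) neg[OF x(2) k(1)] by (simp add: abs_if)
    then have kZ: "nat \<bar>k\<bar> \<in> Z" by (simp add: Z_def)
    have mem: "n \<in> Z \<longleftrightarrow> x (int n) \<noteq> 0" for n by (simp add: Z_def)
    have "Max Z \<in> Z" using fin kZ by (intro Max_in) auto
    then have "x (int (Max Z)) \<noteq> 0" by (simp only: mem not_False_eq_True)
    moreover have "a \<le> Max Z" using Max_ge[OF fin kZ] k(2) by linarith
    moreover have "x i = 0" if "int (Max Z) < i" for i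
    proof (rule ccontr)
      assume "x i \<noteq> 0"
      then have "nat i \<in> Z" using that by (simp add: Z_def)
      from Max_ge[OF fin this] that show False by linarith
    qed
    ultimately show ?thesis by blast
  qed
  obtain k0 where k0: "k0 \<noteq> 0" "E k0 \<noteq> 0" using False by blast
  have "int 1 \<le> \<bar>k0\<bar>" using k0(1) by simp
  then obtain e where e: "1 \<le> e" "E (int e) \<noteq> 0" "\<And>i. int e < i \<Longrightarrow> E i = 0"
    using degree[OF E k0(2)] by blast
  have Q0: "Q k = 0" for k
  proof (rule ccontr)
    assume k: "Q k \<noteq> 0"
    have "int 0 \<le> \<bar>k\<bar>" by simp
    then obtain q where q: "Q (int q) \<noteq> 0" "\<And>i. int q < i \<Longrightarrow> Q i = 0"
      using degree[OF Q k] by blast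
    show False
      using harmonic_commute_top_product[OF comm P(1) Q(1) E(1) e(1,3) q(2)] e(2) q(1) by simp
  qed
  then have "Q = (\<lambda>_. 0)" by auto
  with comm have comm': "entries_commute K P (\<lambda>_. 0) E (\<lambda>_. 0)" by simp
  have rel: "P i * cnj (E l) = E i * cnj (P l)" if "1 \<le> l" "l \<le> i" for i l
  proof -
    have "E i * P (int (nat (i - l)) - i) = P i * E (int (nat (i - l)) - i)"
      using that by (intro harmonic_relation[OF comm' P(1) E(1)]) auto
    moreover have "int (nat (i - l)) - i = - l" using that by simp
    ultimately show ?thesis using P(2) E(2) by (simp add: hermitian_def)
  qed
  have rel': "P i * cnj (E l) = E i * cnj (P l)" if "i \<in> {1..}" "l \<in> {1..}" for i l
  proof (cases "l \<le> i")
    case False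
    then have "cnj (P l * cnj (E i)) = cnj (E l * cnj (P i))"
      using that by (intro arg_cong[where f = cnj] rel) auto
    then show ?thesis by (simp add: mult.commute)
  qed (use that rel in auto)
  obtain t where t: "\<And>i. i \<in> {1..} \<Longrightarrow> P i = of_real t * E i"
    by (rule real_proportional[of "{1..}" P E "int e", OF rel']) (assumption+, use e in simp, use e in simp, blast)
  have "P k = of_real t * E k" if "k \<noteq> 0" for k
  proof (cases "k \<ge> 1")
    case False
    then show ?thesis using that hermitian_eqI[OF P(2) E(2) t[of "- k"]] by simp
  qed (use t in simp)
  then show thesis
    by (intro that[of 1 "- t"]) (auto simp: Q0)
qed

text \<open>
  Commuting real symbols of this form have a nontrivial real combination that is constant: the index 0 is
  excluded for the harmonic coefficients since it is the constant term. If Q = 0, the first symbol is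
  harmonic already; otherwise S = tQ for a real t, and subtracting t times the first symbol from the
  second reduces to a harmonic second symbol.
\<close>
theorem entries_commute_dependent:
  assumes comm: "entries_commute K P Q R S"
    and P: "band_limited K P" "hermitian P" and Q: "band_limited K Q" "hermitian Q"
    and R: "band_limited K R" "hermitian R" and S: "band_limited K S" "hermitian S"
  obtains \<alpha> \<beta> :: real where "(\<alpha>, \<beta>) \<noteq> (0, 0)"
    "\<And>k. of_real \<alpha> * Q k + of_real \<beta> * S k = 0"
    "\<And>k. k \<noteq> 0 \<Longrightarrow> of_real \<alpha> * P k + of_real \<beta> * R k = 0"
proof (cases "\<forall>k. Q k = 0")
  case True
  then have "Q = (\<lambda>_. 0)" by auto
  then have "entries_commute K R S P (\<lambda>_. 0)"
    using entries_commute_sym[OF comm] by simp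
  then obtain \<alpha> \<beta> where "(\<alpha>, \<beta>) \<noteq> (0::real, 0::real)"
    "\<And>k. of_real \<alpha> * S k = 0" "\<And>k. k \<noteq> 0 \<Longrightarrow> of_real \<alpha> * R k + of_real \<beta> * P k = 0"
    by (rule harmonic_commute_dependent[OF _ R S P]) blast+
  then show thesis
    using True by (intro that[of \<beta> \<alpha>]) (auto simp: add.commute)
next
  case False
  have rel: "S i * cnj (Q l) = Q i * cnj (S l)" if "1 \<le> i" "0 \<le> l" "l \<le> i" for i l
  proof -
    have "S i * Q (int (nat (i - l)) - i) = Q i * S (int (nat (i - l)) - i)"
      using that by (intro double_pole_relation[OF comm P(1) Q(1) R(1) S(1)]) auto
    moreover have "int (nat (i - l)) - i = - l" using that by simp
    ultimately show ?thesis using Q(2) S(2) by (simp add: hermitian_def)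
  qed
  have rel': "S i * cnj (Q l) = Q i * cnj (S l)" if il: "i \<in> {0..}" "l \<in> {0..}" for i l
  proof -
    consider "i = 0" "l = 0" | "1 \<le> i" "l \<le> i" | "1 \<le> l" "i \<le> l" using il by force
    then show ?thesis
    proof cases
      case 1
      have "cnj (Q 0) = Q 0" "cnj (S 0) = S 0"
        using Q(2) S(2) unfolding hermitian_def by (metis minus_zero)+
      then show ?thesis using 1 by simp
    next
      case 2
      then show ?thesis using il rel by simp
    next
      case 3
      then have "cnj (S l * cnj (Q i)) = cnj (Q l * cnj (S i))"
        using il by (intro arg_cong[where f = cnj] rel) auto
      then show ?thesis by (simp add: mult.commute)
    qed
  qed
  obtain k where "Q k \<noteq> 0" using False by blast
  then have Qk: "Q \<bar>k\<bar> \<noteq> 0" using Q(2) by (simp add: abs_if hermitian_def)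
  obtain t where t: "\<And>i. i \<in> {0..} \<Longrightarrow> S i = of_real t * Q i"
    by (rule real_proportional[of "{0..}" S Q "\<bar>k\<bar>", OF rel']) (assumption+, simp, rule Qk, blast)
  have St: "S k = of_real t * Q k" for k
  proof (cases "k \<ge> 0")
    case False
    then show ?thesis using hermitian_eqI[OF S(2) Q(2) t[of "- k"]] by simp
  qed (use t in simp)
  let ?E = "\<lambda>k. R k - of_real t * P k"
  have "entries_commute K P Q ?E (\<lambda>k. S k - of_real t * Q k)"
    by (rule entries_commute_diff[OF comm])
  then have comm': "entries_commute K P Q ?E (\<lambda>_. 0)" by (simp add: St)
  have E: "band_limited K ?E" "hermitian ?E"
    using P R by (simp_all add: band_limited_def hermitian_def)
  obtain \<alpha> \<beta> where ab: "(\<alpha>, \<beta>) \<noteq> (0::real, 0::real)" "\<And>k. of_real \<alpha> * Q k = 0"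
    "\<And>k. k \<noteq> 0 \<Longrightarrow> of_real \<alpha> * P k + of_real \<beta> * ?E k = 0"
    by (rule harmonic_commute_dependent[OF comm' P Q E]) blast
  show thesis
  proof (rule that[of "\<alpha> - \<beta> * t" \<beta>])
    show "(\<alpha> - \<beta> * t, \<beta>) \<noteq> (0, 0)" using ab(1) by auto
    show "of_real (\<alpha> - \<beta> * t) * Q k + of_real \<beta> * S k = 0" for k
      using ab(2)[of k] by (simp add: St left_diff_distrib)
    show "of_real (\<alpha> - \<beta> * t) * P k + of_real \<beta> * R k = 0" if "k \<noteq> 0" for k
      using ab(3)[OF that] by (simp add: algebra_simps)
  qed
qed



section \<open>Symbols built from polynomials\<close>

text \<open>
  The coefficient of angular degree k in f + cnj g. At k = 0 both constant terms contribute.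
\<close>
definition harmonic_coeff :: "complex poly \<Rightarrow> complex poly \<Rightarrow> int \<Rightarrow> complex" where
  "harmonic_coeff f g k =
     (if 0 \<le> k then coeff f (nat k) else 0) + (if k \<le> 0 then cnj (coeff g (nat (- k))) else 0)"

definition biharmonic_symbol ::
  "complex poly \<Rightarrow> complex poly \<Rightarrow> complex poly \<Rightarrow> complex poly \<Rightarrow> complex \<Rightarrow> complex" where
  "biharmonic_symbol f1 g1 f2 g2 z =
     (poly f1 z + cnj (poly g1 z)) + complex_of_real ((cmod z)\<^sup>2) * (poly f2 z + cnj (poly g2 z))"

lemma bounded_symbol_poly: "bounded_symbol (poly p)"
  by (rule bounded_symbol_continuous) (intro continuous_intros)

lemma bounded_symbol_biharmonic: "bounded_symbol (biharmonic_symbol f1 g1 f2 g2)"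
  unfolding biharmonic_symbol_def[abs_def]
  by (rule bounded_symbol_continuous) (intro continuous_intros)

lemma L2_inner_poly_power:
  "L2_inner (\<lambda>z. poly p z * disk_power n z) (disk_power m) =
    (if n \<le> m then coeff p (m - n) / (of_nat m + 1) else 0)"
proof -
  have "L2_inner (\<lambda>z. poly p z * disk_power n z) (disk_power m) =
      L2_inner (\<lambda>z. \<Sum>i\<le>degree p. coeff p i * disk_power (i + n) z) (disk_power m)"
    by (rule L2_inner_cong)
       (auto simp: disk_power_def poly_altdef sum_distrib_right power_add mult.assoc)
  also have "\<dots> = (\<Sum>i\<le>degree p. coeff p i * (if i + n = m then 1 / (of_nat m + 1) else 0))"
    by (subst L2_inner_sum_left)
       (auto intro: L2_disk_cmult disk_power_L2 simp: L2_inner_cmult_left L2_inner_disk_power)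
  also have "\<dots> = (\<Sum>i\<in>(if n \<le> m then {m - n} else {}). coeff p i * (if i + n = m then 1 / (of_nat m + 1) else 0))"
    by (rule sum.mono_neutral_cong) (auto intro: coeff_eq_0 split: if_splits)
  finally show ?thesis by auto
qed

lemma L2_inner_cnj_poly_power:
  "L2_inner (\<lambda>z. cnj (poly p z) * disk_power n z) (disk_power m) =
    (if m \<le> n then cnj (coeff p (n - m)) / (of_nat n + 1) else 0)"
proof -
  have "L2_inner (\<lambda>z. cnj (poly p z) * disk_power n z) (disk_power m) =
      cnj (L2_inner (\<lambda>z. poly p z * disk_power m z) (disk_power n))"
    unfolding L2_inner_cnj by (simp add: L2_inner_def mult_ac)
  then show ?thesis by (simp add: L2_inner_poly_power)
qed

lemma L2_inner_harmonic_power: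
  "L2_inner (\<lambda>z. (poly f z + cnj (poly g z)) * disk_power n z) (disk_power m) =
    harmonic_coeff f g (int m - int n) / (of_nat (max n m) + 1)"
proof -
  have "L2_inner (\<lambda>z. (poly f z + cnj (poly g z)) * disk_power n z) (disk_power m) =
      L2_inner (\<lambda>z. poly f z * disk_power n z) (disk_power m) +
      L2_inner (\<lambda>z. cnj (poly g z) * disk_power n z) (disk_power m)"
    unfolding distrib_right
    by (intro L2_inner_add_left bounded_symbol_mult_L2 bounded_symbol_cnj bounded_symbol_poly disk_power_L2)
  also have "\<dots> = harmonic_coeff f g (int m - int n) / (of_nat (max n m) + 1)"
    by (auto simp: L2_inner_poly_power L2_inner_cnj_poly_power harmonic_coeff_def max_def
        nat_diff_distrib' add_divide_distrib)
  finally show ?thesis .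
qed

text \<open>
  Since |z|^2 = z cnj(z), a factor |z|^2 raises both exponents by one, which turns the denominator
  max n m + 1 into max n m + 2.
\<close>
lemma L2_inner_biharmonic_power:
  "L2_inner (\<lambda>z. biharmonic_symbol f1 g1 f2 g2 z * disk_power n z) (disk_power m) =
    moment_entry (harmonic_coeff f1 g1) (harmonic_coeff f2 g2) n m"
proof -
  let ?h1 = "\<lambda>z. poly f1 z + cnj (poly g1 z)" and ?h2 = "\<lambda>z. poly f2 z + cnj (poly g2 z)"
  have h: "bounded_symbol ?h1" "bounded_symbol (\<lambda>z. complex_of_real ((cmod z)\<^sup>2) * ?h2 z)"
    by (rule bounded_symbol_continuous, intro continuous_intros)+
  have "L2_inner (\<lambda>z. biharmonic_symbol f1 g1 f2 g2 z * disk_power n z) (disk_power m) =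
      L2_inner (\<lambda>z. ?h1 z * disk_power n z) (disk_power m) +
      L2_inner (\<lambda>z. (complex_of_real ((cmod z)\<^sup>2) * ?h2 z) * disk_power n z) (disk_power m)"
    unfolding biharmonic_symbol_def distrib_right[of "?h1 _"]
    by (intro L2_inner_add_left bounded_symbol_mult_L2 h disk_power_L2)
  also have "L2_inner (\<lambda>z. (complex_of_real ((cmod z)\<^sup>2) * ?h2 z) * disk_power n z) (disk_power m) =
      L2_inner (\<lambda>z. ?h2 z * disk_power (n + 1) z) (disk_power (m + 1))"
    unfolding L2_inner_def
    by (rule Bochner_Integration.integral_cong[OF refl])
       (simp only: disk_power_def complex_norm_square, simp add: mult_ac)
  also have "L2_inner (\<lambda>z. ?h1 z * disk_power n z) (disk_power m) + \<dots> =
      moment_entry (harmonic_coeff f1 g1) (harmonic_coeff f2 g2) n m"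
    unfolding L2_inner_harmonic_power
    by (auto simp: moment_entry_def weight_def max_def add_ac)
  finally show ?thesis .
qed

text \<open>
  Coefficients of the real part of the symbol with coefficients A; those of the conjugate symbol are
  cnj (A (- k)).
\<close>
definition real_part_coeff :: "(int \<Rightarrow> complex) \<Rightarrow> int \<Rightarrow> complex" where
  "real_part_coeff A k = (A k + cnj (A (- k))) / 2"

definition imag_part_coeff :: "(int \<Rightarrow> complex) \<Rightarrow> int \<Rightarrow> complex" where
  "imag_part_coeff A k = (A k - cnj (A (- k))) / (2 * \<i>)"

lemma hermitian_real_part: "hermitian (real_part_coeff A)"
  by (simp add: hermitian_def real_part_coeff_def add.commute)

lemma hermitian_imag_part: "hermitian (imag_part_coeff A)"
  by (simp add: hermitian_def imag_part_coeff_def field_simps)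

lemma band_limited_parts:
  assumes "band_limited K A"
  shows "band_limited K (real_part_coeff A)" "band_limited K (imag_part_coeff A)"
  using assms by (simp_all add: band_limited_def real_part_coeff_def imag_part_coeff_def)

lemma band_limited_harmonic_coeff:
  assumes "degree f \<le> K" "degree g \<le> K"
  shows "band_limited K (harmonic_coeff f g)"
  using assms by (auto simp: band_limited_def harmonic_coeff_def intro!: coeff_eq_0)

lemma moment_entry_parts:
  "moment_entry A B n m = moment_entry (real_part_coeff A) (real_part_coeff B) n m
    + \<i> * moment_entry (imag_part_coeff A) (imag_part_coeff B) n m"
proof -
  have "A k = real_part_coeff A k + \<i> * imag_part_coeff A k" for A k
    by (simp add: real_part_coeff_def imag_part_coeff_def field_simps)
  then have "moment_entry A B n m = moment_entry (\<lambda>k. real_part_coeff A k + \<i> * imag_part_coeff A k)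
      (\<lambda>k. real_part_coeff B k + \<i> * imag_part_coeff B k) n m"
    by presburger
  then show ?thesis
    by (simp add: moment_entry_def weight_def add_divide_distrib distrib_left)
qed

lemma cnj_moment_entry_parts:
  "cnj (moment_entry A B m n) = moment_entry (real_part_coeff A) (real_part_coeff B) n m
    - \<i> * moment_entry (imag_part_coeff A) (imag_part_coeff B) n m"
proof -
  have "cnj (A (- k)) = real_part_coeff A k - \<i> * imag_part_coeff A k" for A k
    by (simp add: real_part_coeff_def imag_part_coeff_def field_simps)
  from this[of A "int m - int n"] this[of B "int m - int n"]
  show ?thesis
    by (simp add: moment_entry_def weight_def diff_divide_distrib right_diff_distrib distrib_left max.commute)
qed

text \<open>
  With T = U + iV and T* = U - iV, the difference of the inner products of T z^n, T z^m and of T* z^n, T* z^m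
  is 2i times the (n, m) entry of the commutator of V and U.
\<close>
lemma normal_imp_entries_commute:
  assumes normal: "bergman_normal (toeplitz (biharmonic_symbol f1 g1 f2 g2))"
    and K: "degree f1 \<le> K" "degree g1 \<le> K" "degree f2 \<le> K" "degree g2 \<le> K"
  defines "A \<equiv> harmonic_coeff f1 g1" and "B \<equiv> harmonic_coeff f2 g2"
  shows "entries_commute K (real_part_coeff A) (real_part_coeff B) (imag_part_coeff A) (imag_part_coeff B)"
  unfolding entries_commute_def
proof (intro allI)
  fix n m
  let ?\<Phi> = "biharmonic_symbol f1 g1 f2 g2"
  let ?S = "toeplitz (\<lambda>z. cnj (?\<Phi> z))"
  define U where "U = moment_entry (real_part_coeff A) (real_part_coeff B)"
  define V where "V = moment_entry (imag_part_coeff A) (imag_part_coeff B)"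
  have \<Phi>: "bounded_symbol ?\<Phi>" by (rule bounded_symbol_biharmonic)
  have T: "L2_inner (toeplitz ?\<Phi> (disk_power n)) (disk_power j) = U n j + \<i> * V n j" for n j
    unfolding L2_inner_toeplitz[OF \<Phi> disk_power_bergman disk_power_bergman] L2_inner_biharmonic_power
      U_def V_def A_def B_def by (rule moment_entry_parts)
  have S: "L2_inner (?S (disk_power n)) (disk_power j) = U n j - \<i> * V n j" for n j
  proof -
    have "L2_inner (?S (disk_power n)) (disk_power j) = cnj (L2_inner (toeplitz ?\<Phi> (disk_power j)) (disk_power n))"
      unfolding toeplitz_adjoint[OF \<Phi> disk_power_bergman disk_power_bergman] by (rule L2_inner_cnj[symmetric])
    then show ?thesis
      unfolding L2_inner_toeplitz[OF \<Phi> disk_power_bergman disk_power_bergman] L2_inner_biharmonic_power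
        U_def V_def A_def B_def cnj_moment_entry_parts .
  qed
  have cnj_S: "cnj (U m j - \<i> * V m j) = U j m + \<i> * V j m" and cnj_T: "cnj (U m j + \<i> * V m j) = U j m - \<i> * V j m" for j
    using cnj_moment_entry_parts[of A B m j] moment_entry_parts[of A B j m]
      arg_cong[OF cnj_moment_entry_parts[of A B j m], where f = cnj] moment_entry_parts[of A B m j]
    by (simp_all only: U_def V_def complex_cnj_cnj)
  have vanish: "U m j = 0" "V m j = 0" if "j > m + K" for j
  proof -
    have "\<bar>int j - int m\<bar> > int K" using that by auto
    moreover have "band_limited K A" "band_limited K B"
      unfolding A_def B_def using K by (auto intro: band_limited_harmonic_coeff)
    ultimately show "U m j = 0" "V m j = 0"
      using band_limited_parts[of K A] band_limited_parts[of K B]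
      by (simp_all add: U_def V_def moment_entry_def weight_def band_limited_def)
  qed
  have "0 = L2_inner (toeplitz ?\<Phi> (disk_power n)) (toeplitz ?\<Phi> (disk_power m)) -
      L2_inner (?S (disk_power n)) (?S (disk_power m))"
    using toeplitz_normal_inner[OF \<Phi> normal disk_power_bergman disk_power_bergman] by simp
  also have "\<dots> = (\<Sum>j\<le>m + K. (of_nat j + 1) * (U n j + \<i> * V n j) * cnj (U m j + \<i> * V m j)) -
      (\<Sum>j\<le>m + K. (of_nat j + 1) * (U n j - \<i> * V n j) * cnj (U m j - \<i> * V m j))"
    using toeplitz_bergman[OF \<Phi> disk_power_bergman] toeplitz_bergman[OF bounded_symbol_cnj[OF \<Phi>] disk_power_bergman]
    by (subst (1 2) bergman_parseval[where J = "m + K"]) (simp_all only: T S, simp_all add: vanish)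
  also have "\<dots> = 2 * \<i> * (\<Sum>j\<le>m + K. (of_nat j + 1) * (V n j * U j m - U n j * V j m))"
    unfolding cnj_S cnj_T sum_distrib_left sum_subtractf[symmetric]
    by (intro sum.cong refl) (simp add: algebra_simps)
  finally show "(\<Sum>j\<le>m + K. (of_nat j + 1) *
      (moment_entry (imag_part_coeff A) (imag_part_coeff B) n j * moment_entry (real_part_coeff A) (real_part_coeff B) j m
       - moment_entry (real_part_coeff A) (real_part_coeff B) n j * moment_entry (imag_part_coeff A) (imag_part_coeff B) j m)) = 0"
    by (simp add: U_def V_def)
qed

text \<open>
  With c = \<alpha> - i\<beta> the combination \<alpha>u + \<beta>v is Re (c\<Phi>). The real part of c (f + cnj g) is that of the
  polynomial c f + cnj(c) g, which the relations between coefficients make constant. For the pair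
  f1, g1 this constant is the value of Re (c\<Phi>); for f2, g2 it has real part 0. So \<Phi> moves only in the
  direction i / c.
\<close>
lemma parts_dependent_imp_collinear:
  fixes \<alpha> \<beta> :: real and f1 g1 f2 g2 :: "complex poly"
  defines "A \<equiv> harmonic_coeff f1 g1" and "B \<equiv> harmonic_coeff f2 g2"
  assumes nz: "(\<alpha>, \<beta>) \<noteq> (0, 0)"
    and B: "\<And>k. of_real \<alpha> * real_part_coeff B k + of_real \<beta> * imag_part_coeff B k = 0"
    and A: "\<And>k. k \<noteq> 0 \<Longrightarrow> of_real \<alpha> * real_part_coeff A k + of_real \<beta> * imag_part_coeff A k = 0"
  shows "collinear (biharmonic_symbol f1 g1 f2 g2 ` X)"
proof -
  define c where "c = Complex \<alpha> (- \<beta>)"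
  have c: "c \<noteq> 0" using nz by (auto simp: c_def complex_eq_iff)
  have combine: "of_real \<alpha> * real_part_coeff D k + of_real \<beta> * imag_part_coeff D k = (c * D k + cnj (c * D (- k))) / 2" for D k
  proof -
    have im: "x / (2 * \<i>) = - \<i> * x / 2" for x by (simp add: field_simps)
    have c_eq: "c = of_real \<alpha> - \<i> * of_real \<beta>" "cnj c = of_real \<alpha> + \<i> * of_real \<beta>"
      by (simp_all add: c_def complex_eq_iff)
    show ?thesis
      unfolding real_part_coeff_def imag_part_coeff_def im complex_cnj_mult c_eq
      by (simp add: add_divide_distrib diff_divide_distrib algebra_simps)
  qed
  define h where "h = (\<lambda>f g. smult c f + smult (cnj c) g)"
  have h_coeff: "coeff (h f g) k = 0" if "k > 0" "c * harmonic_coeff f g (int k) + cnj (c * harmonic_coeff f g (- int k)) = 0" for f g k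
    using that by (simp add: h_def harmonic_coeff_def)
  have h_const: "poly (h f g) z = coeff (h f g) 0" if "\<And>k. k > 0 \<Longrightarrow> coeff (h f g) k = 0" for f g z
  proof -
    have "degree (h f g) = 0" using that by (metis le_degree leading_coeff_0_iff degree_0 gr0I)
    then obtain a where "h f g = [:a:]" by (rule degree_eq_zeroE)
    then show ?thesis by simp
  qed
  have h1: "poly (h f1 g1) z = coeff (h f1 g1) 0" for z
    using A unfolding combine A_def by (intro h_const h_coeff) auto
  have h2: "poly (h f2 g2) z = coeff (h f2 g2) 0" for z
    using B unfolding combine B_def by (intro h_const h_coeff) auto
  have h20: "Re (coeff (h f2 g2) 0) = 0"
    using B[of 0] unfolding combine B_def by (simp add: h_def harmonic_coeff_def complex_eq_iff field_simps)
  have Re_h: "Re (c * (poly f z + cnj (poly g z))) = Re (poly (h f g) z)" for f g z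
    by (simp add: h_def algebra_simps)
  have Re_const: "Re (c * biharmonic_symbol f1 g1 f2 g2 z) = Re (coeff (h f1 g1) 0)" for z
  proof -
    have "Re (c * biharmonic_symbol f1 g1 f2 g2 z) =
        Re (c * (poly f1 z + cnj (poly g1 z))) + (cmod z)\<^sup>2 * Re (c * (poly f2 z + cnj (poly g2 z)))"
      by (simp add: biharmonic_symbol_def algebra_simps)
    then show ?thesis by (simp only: Re_h h1 h2 h20 mult_zero_right add_0_right)
  qed
  show ?thesis
    unfolding collinear_def
  proof (intro exI[of _ "\<i> / c"] ballI)
    fix x y assume "x \<in> biharmonic_symbol f1 g1 f2 g2 ` X" "y \<in> biharmonic_symbol f1 g1 f2 g2 ` X"
    then have "Re (c * (x - y)) = 0"
      using Re_const unfolding right_diff_distrib minus_complex.sel by auto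
    then have "c * (x - y) = of_real (Im (c * (x - y))) * \<i>"
      by (simp add: complex_eq_iff)
    then have "x - y = Im (c * (x - y)) *\<^sub>R (\<i> / c)"
      using c by (simp add: scaleR_conv_of_real field_simps)
    then show "\<exists>t. x - y = t *\<^sub>R (\<i> / c)" ..
  qed
qed

lemma collinear_imp_cnj_affine:
  assumes "collinear (u ` X)"
  obtains \<kappa> \<mu> where "\<And>z. z \<in> X \<Longrightarrow> cnj (u z) = \<kappa> * u z + \<mu>"
proof (cases "X = {}")
  case True
  then show thesis by (intro that) auto
next
  case False
  then obtain z0 where z0: "z0 \<in> X" by blast
  obtain v where v: "\<And>x y. x \<in> u ` X \<Longrightarrow> y \<in> u ` X \<Longrightarrow> \<exists>t. x - y = t *\<^sub>R v"
    using assms unfolding collinear_def by blast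
  \<comment> \<open>If v = 0, the quotient is 0 by convention; u is then constant and the claim still holds.\<close>
  define \<kappa> where "\<kappa> = cnj v / v"
  show thesis
  proof (rule that[of \<kappa> "cnj (u z0) - \<kappa> * u z0"])
    fix z assume "z \<in> X"
    then obtain t where t: "u z = u z0 + of_real t * v"
      using v[of "u z" "u z0"] z0 by (auto simp: scaleR_conv_of_real algebra_simps)
    have "cnj v = \<kappa> * v" by (simp add: \<kappa>_def)
    then show "cnj (u z) = \<kappa> * u z + (cnj (u z0) - \<kappa> * u z0)"
      by (simp add: t algebra_simps)
  qed
qed

theorem corollary1:
  fixes f1 f2 g1 g2 :: "complex poly" and \<phi>1 \<phi>2 \<Phi> :: "complex \<Rightarrow> complex"
  assumes "lead_coeff f1 * lead_coeff g1 \<noteq> 0"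
    and "lead_coeff f2 * lead_coeff g2 \<noteq> 0"
    and "\<And>z. \<phi>1 z = poly f1 z + cnj (poly g1 z)"
    and "\<And>z. \<phi>2 z = poly f2 z + cnj (poly g2 z)"
    and "\<And>z. \<Phi> z = \<phi>1 z + complex_of_real ((cmod z)\<^sup>2) * \<phi>2 z"
  shows "bergman_normal (toeplitz \<Phi>) \<longleftrightarrow>
           \<Phi> constant_on unit_disk \<or> collinear (\<Phi> ` unit_disk)"
proof -
  have \<Phi>: "\<Phi> = biharmonic_symbol f1 g1 f2 g2"
    using assms(3-5) by (simp add: fun_eq_iff biharmonic_symbol_def)
  have "collinear (\<Phi> ` unit_disk)" if const: "\<Phi> constant_on unit_disk"
  proof -
    obtain w where "\<Phi> ` unit_disk \<subseteq> {w}"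
      using const unfolding constant_on_def by blast
    then show ?thesis by (rule collinear_subset[OF collinear_sing])
  qed
  moreover have "bergman_normal (toeplitz \<Phi>)" if coll: "collinear (\<Phi> ` unit_disk)"
  proof -
    obtain \<kappa> \<mu> where "\<And>z. z \<in> unit_disk \<Longrightarrow> cnj (\<Phi> z) = \<kappa> * \<Phi> z + \<mu>"
      using collinear_imp_cnj_affine[OF coll] by blast
    then show ?thesis
      unfolding \<Phi> by (rule toeplitz_normalI[OF bounded_symbol_biharmonic])
  qed
  moreover have "collinear (\<Phi> ` unit_disk)" if normal: "bergman_normal (toeplitz \<Phi>)"
  proof -
    define K where "K = Max {degree f1, degree g1, degree f2, degree g2}"
    have K: "degree f1 \<le> K" "degree g1 \<le> K" "degree f2 \<le> K" "degree g2 \<le> K"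
      by (auto simp: K_def)
    let ?A = "harmonic_coeff f1 g1" and ?B = "harmonic_coeff f2 g2"
    have A: "band_limited K ?A" and B: "band_limited K ?B"
      using K by (auto intro: band_limited_harmonic_coeff)
    obtain \<alpha> \<beta> :: real where "(\<alpha>, \<beta>) \<noteq> (0, 0)"
      "\<And>k. of_real \<alpha> * real_part_coeff ?B k + of_real \<beta> * imag_part_coeff ?B k = 0"
      "\<And>k. k \<noteq> 0 \<Longrightarrow> of_real \<alpha> * real_part_coeff ?A k + of_real \<beta> * imag_part_coeff ?A k = 0"
      by (rule entries_commute_dependent[OF normal_imp_entries_commute[OF normal[unfolded \<Phi>] K]
            band_limited_parts(1)[OF A] hermitian_real_part band_limited_parts(1)[OF B] hermitian_real_part
            band_limited_parts(2)[OF A] hermitian_imag_part band_limited_parts(2)[OF B] hermitian_imag_part])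
         blast
    then show ?thesis
      unfolding \<Phi> by (rule parts_dependent_imp_collinear)
  qed
  ultimately show ?thesis by blast
qed

end
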